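(* Let $\mathcal{C}$ be an arbitrary set of corner minors of $M$. Let $U=(a_{ij}\mid x_{ij}\in V(\mathcal{C}))$ and $V=(b_{ij}\mid x_{ij}\in V(\mathcal{C}))$ be two contingency tables. Then $U$ and $V$ are connected via $\mathcal{B}_{\mathcal{C}}$ if (1) the inequalities $\sum_{x_{ij}\in W}a_{ij}\ge 2$ and $\sum_{x_{ij}\in W}b_{ij}\ge 2$ hold for all $W\in\mathcal{W}\setminus\{\emptyset\}$; and (2) the tables $U$ and $V$ have the same row sums and the same column sums, and there is a cycle $\sigma:h_{i_1},v_{j_1},\dots,h_{i_r},v_{j_r}$ in $G(\mathcal{C})$ such that every nonzero entry of $U$ and of $V$ is at a position corresponding to one of the vertices $x_{a_{i_k},b_{j_k}}$, $x_{a_{i_{k+1}},b_{j_k}}$ ($1\le k\le r$, $i_{r+1}=i_1$) of $\sigma$.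
   Context: Let $K$ be a field and $M=(x_{ij})$ an $m\times n$ matrix of indeterminates. A 2-minor is $\delta=[a_1,a_2|b_1,b_2]$ with $a_1<a_2$, $b_1<b_2$; $f_\delta=x_{a_1b_1}x_{a_2b_2}-x_{a_1b_2}x_{a_2b_1}$. Its vertex set is $V(\delta)=\{x_{a_1b_1},x_{a_1b_2},x_{a_2b_1},x_{a_2b_2}\}$; its edges are the horizontal edges $\{x_{a_1b_1},x_{a_1b_2}\}$, $\{x_{a_2b_1},x_{a_2b_2}\}$ and the vertical edges $\{x_{a_1b_1},x_{a_2b_1}\}$, $\{x_{a_1b_2},x_{a_2b_2}\}$. It is a corner minor if $a_1=1$ and $b_1=1$. For a set $\mathcal{C}$ of 2-minors, $V(\mathcal{C})$ and $E(\mathcal{C})$ are the unions of the vertex sets and edge sets of its members, $S=K[x_{ij}\mid x_{ij}\in V(\mathcal{C})]$, and $I(\mathcal{C})=(f_\delta\mid\delta\in\mathcal{C})\subset S$. A vertical interval of $\mathcal{C}$ is a set of vertices of $V(\mathcal{C})$ lying in one column of $M$ such that any two of them are joined by a path of vertical edges of $\mathcal{C}$; it is maximal if it is not strictly contained in another vertical interval. (Maximal) horizontal intervals are defined analogously with rows and horizontal edges. Let $V_1,\dots,V_p$ and $H_1,\dots,H_q$ be the maximal vertical and maximal horizontal intervals of $\mathcal{C}$. $G(\mathcal{C})$ is the bipartite graph with vertices $v_1,\dots,v_p,h_1,\dots,h_q$ and edges $\{h_i,v_j\}$ for $H_i\cap V_j\ne\emptyset$; in that case $H_i\cap V_j$ is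 a single vertex, denoted $x_{a_i b_j}$. For a cycle $\sigma:h_{i_1},v_{j_1},\dots,h_{i_r},v_{j_r}$ ($r\ge2$) in $G(\mathcal{C})$ put $f_\sigma=\prod_{k=1}^r x_{a_{i_k},b_{j_k}}-\prod_{k=1}^r x_{a_{i_{k+1}},b_{j_k}}$ with $i_{r+1}=i_1$. $J_{\mathcal{C}}$ is the ideal generated by all $f_\sigma$, $\sigma$ a cycle in $G(\mathcal{C})$. For $\mathcal{D}\subset\mathcal{C}$, $J_{\mathcal{D}}$ is formed from the intervals of $\mathcal{D}$ and regarded as an ideal of $S$ by extension (zero if $\mathcal{D}=\emptyset$). A subset $W\subset V(\mathcal{C})$ is admissible if for each $\delta\in\mathcal{C}$ either $W\cap V(\delta)=\emptyset$ or $W\cap V(\delta)$ contains an edge of $\delta$. For admissible $W$, $P_W(\mathcal{C})=(x_{ij}\mid x_{ij}\in W)+J_{\mathcal{C}'}\subset S$ with $\mathcal{C}'=\{\delta\in\mathcal{C}\mid V(\delta)\cap W=\emptyset\}$. $\mathcal{W}$ denotes the set of all admissible $W\subset V(\mathcal{C})$ such that $P_W(\mathcal{C})$ is a minimal prime of $I(\mathcal{C})$. A contingency table here is a family of nonnegative integers indexed by $V(\mathcal{C})$; the row (column) sums are the sums of entries over the positions of $V(\mathcal{C})$ in a given row (column) of $M$. $\mathcal{B}_{\mathcal{C}}\subset\mathbb{Z}^{V(\mathcal{C})}$ is the set of vectors $e_{a_1b_1}+e_{a_2b_2}-e_{a_1b_2}-e_{a_2b_1}$ for $[a_1,a_2|b_1,b_2]\in\mathcal{C}$,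 where $e_{ij}$ are the standard basis vectors. Two tables are connected via $\mathcal{B}_{\mathcal{C}}$ if they lie in the same connected component of the graph with vertex set $\mathbb{N}^{V(\mathcal{C})}$ in which $u,v$ are adjacent if and only if $u-v\in\pm\mathcal{B}_{\mathcal{C}}$. *)

theory Defs
  imports "HOL-Library.Poly_Mapping" "HOL-Algebra.Ideal"
begin

section \<open>2-minors and their vertices and edges\<close>

text \<open>The position \<open>(i, j)\<close> stands for the indeterminate \<open>x\<^sub>i\<^sub>j\<close>; rows and columns are
  numbered from 1. \<open>Minor a1 a2 b1 b2\<close> is \<open>[a1,a2|b1,b2]\<close>.\<close>

type_synonym pos = "nat \<times> nat"

datatype minor = Minor nat nat nat nat

definition minors :: "nat \<Rightarrow> nat \<Rightarrow> minor set" where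
  "minors m n =
     {Minor a1 a2 b1 b2 | a1 a2 b1 b2. 1 \<le> a1 \<and> a1 < a2 \<and> a2 \<le> m \<and> 1 \<le> b1 \<and> b1 < b2 \<and> b2 \<le> n}"

fun corner :: "minor \<Rightarrow> bool" where
  "corner (Minor a1 a2 b1 b2) \<longleftrightarrow> a1 = 1 \<and> b1 = 1"

fun verts :: "minor \<Rightarrow> pos set" where
  "verts (Minor a1 a2 b1 b2) = {(a1, b1), (a1, b2), (a2, b1), (a2, b2)}"

fun hedges :: "minor \<Rightarrow> pos set set" where
  "hedges (Minor a1 a2 b1 b2) = {{(a1, b1), (a1, b2)}, {(a2, b1), (a2, b2)}}"

fun vedges :: "minor \<Rightarrow> pos set set" where
  "vedges (Minor a1 a2 b1 b2) = {{(a1, b1), (a2, b1)}, {(a1, b2), (a2, b2)}}"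

definition edges :: "minor \<Rightarrow> pos set set" where
  "edges \<delta> = hedges \<delta> \<union> vedges \<delta>"

definition Verts :: "minor set \<Rightarrow> pos set" where
  "Verts C = (\<Union>\<delta>\<in>C. verts \<delta>)"


section \<open>Intervals and the bipartite graph\<close>

definition joined :: "pos set set \<Rightarrow> pos \<Rightarrow> pos \<Rightarrow> bool" where
  "joined E x y \<longleftrightarrow> (x, y) \<in> {(u, v). {u, v} \<in> E}\<^sup>*"

definition vertical_interval :: "minor set \<Rightarrow> pos set \<Rightarrow> bool" where
  "vertical_interval C A \<longleftrightarrow> A \<subseteq> Verts C \<and> (\<exists>j. \<forall>x\<in>A. snd x = j) \<and>
     (\<forall>x\<in>A. \<forall>y\<in>A. joined (\<Union>\<delta>\<in>C. vedges \<delta>) x y)"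

definition horizontal_interval :: "minor set \<Rightarrow> pos set \<Rightarrow> bool" where
  "horizontal_interval C A \<longleftrightarrow> A \<subseteq> Verts C \<and> (\<exists>i. \<forall>x\<in>A. fst x = i) \<and>
     (\<forall>x\<in>A. \<forall>y\<in>A. joined (\<Union>\<delta>\<in>C. hedges \<delta>) x y)"

definition max_vertical :: "minor set \<Rightarrow> pos set set" where
  "max_vertical C = {A. vertical_interval C A \<and> \<not> (\<exists>B. vertical_interval C B \<and> A \<subset> B)}"

definition max_horizontal :: "minor set \<Rightarrow> pos set set" where
  "max_horizontal C = {A. horizontal_interval C A \<and> \<not> (\<exists>B. horizontal_interval C B \<and> A \<subset> B)}"

text \<open>The vertices \<open>h\<^sub>i\<close> and \<open>v\<^sub>j\<close> of the bipartite graph are \<open>Inl H\<^sub>i\<close> and \<open>Inr V\<^sub>j\<close>.\<close>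

definition graph_edges :: "minor set \<Rightarrow> (pos set + pos set) set set" where
  "graph_edges C =
     {{Inl H, Inr V} | H V. H \<in> max_horizontal C \<and> V \<in> max_vertical C \<and> H \<inter> V \<noteq> {}}"

text \<open>The lists \<open>hs\<close> and \<open>vs\<close> describe the cycle
  \<open>hs ! 0, vs ! 0, hs ! 1, vs ! 1, \<dots>, hs ! (r - 1), vs ! (r - 1)\<close>, closing up at \<open>hs ! 0\<close>.\<close>

definition is_cycle :: "minor set \<Rightarrow> pos set list \<Rightarrow> pos set list \<Rightarrow> bool" where
  "is_cycle C hs vs \<longleftrightarrow> length hs = length vs \<and> 2 \<le> length hs \<and> distinct hs \<and> distinct vs \<and>
     (\<forall>k<length hs. {Inl (hs ! k), Inr (vs ! k)} \<in> graph_edges C \<and>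
        {Inl (hs ! (Suc k mod length hs)), Inr (vs ! k)} \<in> graph_edges C)"

text \<open>A maximal horizontal and a maximal vertical interval meet in at most one position, so along
  a cycle \<open>the_elem\<close> picks out that position.\<close>

definition cyc_pos :: "pos set list \<Rightarrow> pos set list \<Rightarrow> nat \<Rightarrow> pos" where
  "cyc_pos hs vs k = the_elem (hs ! k \<inter> vs ! k)"

definition cyc_pos' :: "pos set list \<Rightarrow> pos set list \<Rightarrow> nat \<Rightarrow> pos" where
  "cyc_pos' hs vs k = the_elem (hs ! (Suc k mod length hs) \<inter> vs ! k)"

definition cyc_verts :: "pos set list \<Rightarrow> pos set list \<Rightarrow> pos set" where
  "cyc_verts hs vs = cyc_pos hs vs ` {..<length hs} \<union> cyc_pos' hs vs ` {..<length hs}"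


section \<open>Polynomials and ideals\<close>

text \<open>Polynomials in all indeterminates \<open>x\<^sub>i\<^sub>j\<close>: a finitely supported function from monomials
  (finitely supported exponent families) to coefficients. \<open>poly_ring C\<close> consists of those in which
  only indeterminates from \<open>Verts C\<close> occur.\<close>

type_synonym 'k mpoly = "(pos \<Rightarrow>\<^sub>0 nat) \<Rightarrow>\<^sub>0 'k"

definition var :: "pos \<Rightarrow> 'k::field mpoly" where
  "var x = Poly_Mapping.single (Poly_Mapping.single x 1) 1"

definition poly_ring :: "minor set \<Rightarrow> 'k::field mpoly ring" where
  "poly_ring C = \<lparr>carrier = {p. \<forall>t \<in> Poly_Mapping.keys p. Poly_Mapping.keys t \<subseteq> Verts C},
     mult = (*), one = 1, zero = 0, add = (+)\<rparr>"

fun minor_poly :: "minor \<Rightarrow> 'k::field mpoly" where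
  "minor_poly (Minor a1 a2 b1 b2) = var (a1, b1) * var (a2, b2) - var (a1, b2) * var (a2, b1)"

definition minor_ideal :: "minor set \<Rightarrow> 'k::field mpoly set" where
  "minor_ideal C = Idl\<^bsub>poly_ring C\<^esub> (minor_poly ` C)"

definition cyc_poly :: "pos set list \<Rightarrow> pos set list \<Rightarrow> 'k::field mpoly" where
  "cyc_poly hs vs = (\<Prod>k<length hs. var (cyc_pos hs vs k)) - (\<Prod>k<length hs. var (cyc_pos' hs vs k))"

text \<open>\<open>cycle_ideal C D\<close> is the ideal generated by the cycle binomials of \<open>D \<subseteq> C\<close>, extended
  to \<open>poly_ring C\<close>.\<close>

definition cycle_ideal :: "minor set \<Rightarrow> minor set \<Rightarrow> 'k::field mpoly set" where
  "cycle_ideal C D = Idl\<^bsub>poly_ring C\<^esub> {cyc_poly hs vs | hs vs. is_cycle D hs vs}"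

definition admissible :: "minor set \<Rightarrow> pos set \<Rightarrow> bool" where
  "admissible C W \<longleftrightarrow> W \<subseteq> Verts C \<and>
     (\<forall>\<delta>\<in>C. W \<inter> verts \<delta> = {} \<or> (\<exists>e\<in>edges \<delta>. e \<subseteq> W \<inter> verts \<delta>))"

definition P_ideal :: "minor set \<Rightarrow> pos set \<Rightarrow> 'k::field mpoly set" where
  "P_ideal C W = Idl\<^bsub>poly_ring C\<^esub> (var ` W)
     <+>\<^bsub>poly_ring C\<^esub> cycle_ideal C {\<delta> \<in> C. verts \<delta> \<inter> W = {}}"

definition minimal_prime :: "('a, 'b) ring_scheme \<Rightarrow> 'a set \<Rightarrow> 'a set \<Rightarrow> bool" where
  "minimal_prime R A Q \<longleftrightarrow> primeideal Q R \<and> A \<subseteq> Q \<and>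
     \<not> (\<exists>Q'. primeideal Q' R \<and> A \<subseteq> Q' \<and> Q' \<subset> Q)"

text \<open>The argument of type \<open>'k itself\<close> only names the coefficient field.\<close>

definition min_prime_sets :: "'k::field itself \<Rightarrow> minor set \<Rightarrow> pos set set" where
  "min_prime_sets K C =
     {W. admissible C W \<and> minimal_prime (poly_ring C) (minor_ideal C) (P_ideal C W :: 'k mpoly set)}"


section \<open>Contingency tables\<close>

text \<open>A family indexed by \<open>Verts C\<close> is a function on all positions that vanishes outside
  \<open>Verts C\<close>.\<close>

definition tables :: "minor set \<Rightarrow> (pos \<Rightarrow> nat) set" where
  "tables C = {u. \<forall>x. x \<notin> Verts C \<longrightarrow> u x = 0}"

definition row_sum :: "minor set \<Rightarrow> (pos \<Rightarrow> nat) \<Rightarrow> nat \<Rightarrow> nat" where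
  "row_sum C u i = (\<Sum>x\<in>{x \<in> Verts C. fst x = i}. u x)"

definition col_sum :: "minor set \<Rightarrow> (pos \<Rightarrow> nat) \<Rightarrow> nat \<Rightarrow> nat" where
  "col_sum C u j = (\<Sum>x\<in>{x \<in> Verts C. snd x = j}. u x)"

definition unit_vec :: "pos \<Rightarrow> pos \<Rightarrow> int" where
  "unit_vec x = (\<lambda>y. if y = x then 1 else 0)"

fun move :: "minor \<Rightarrow> pos \<Rightarrow> int" where
  "move (Minor a1 a2 b1 b2) = (\<lambda>x. unit_vec (a1, b1) x + unit_vec (a2, b2) x
     - unit_vec (a1, b2) x - unit_vec (a2, b1) x)"

definition moves :: "minor set \<Rightarrow> (pos \<Rightarrow> int) set" where
  "moves C = move ` C"

definition adjacent_tables :: "minor set \<Rightarrow> ((pos \<Rightarrow> nat) \<times> (pos \<Rightarrow> nat)) set" where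
  "adjacent_tables C = {(u, v). u \<in> tables C \<and> v \<in> tables C \<and>
     (\<exists>b\<in>moves C. (\<lambda>x. int (u x) - int (v x)) = b \<or> (\<lambda>x. int (u x) - int (v x)) = (\<lambda>x. - b x))}"

definition connected_via :: "minor set \<Rightarrow> (pos \<Rightarrow> nat) \<Rightarrow> (pos \<Rightarrow> nat) \<Rightarrow> bool" where
  "connected_via C u v \<longleftrightarrow> u \<in> tables C \<and> v \<in> tables C \<and> (u, v) \<in> (adjacent_tables C)\<^sup>*"

end

theory Submission
  imports Defs "HOL-Library.Product_Lexorder" "HOL-Library.Multiset"
begin

text \<open>A set of corner minors is a bipartite graph \<open>B\<close> between the rows and the columns other
  than the first, and the positions of a given row or column form a single interval. Hence
  \<open>U - V\<close> is a multiple \<open>d\<close> of the alternating vector of the cycle, and by induction on \<open>d\<close> only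
  one exchange along the cycle has to be realised at a time. A spare unit at the corner \<open>(1, 1)\<close>,
  possibly obtained by one move from an edge of \<open>B\<close> with both border positions occupied, suffices
  to exchange step by step along a cycle through the first row. Without such a spare, the border
  positions occupied by the units not taking part in the exchange form an independent set of \<open>B\<close>.

  If an independent set contains a vertex with another vertex at distance two, then the border
  positions outside of it (a vertex cover together with the corner) contain a nonempty \<open>W\<close> such
  that \<open>P\<^sub>W\<close> is a minimal prime: a prime that contains the minors but not the corner variable
  contains a binomial that is not in \<open>P\<^sub>W\<close>. So both tables have at least two units on \<open>W\<close>. A
  suitable extension of the independent set of occupied positions violates this, unless the cycle
  is so short that at most two moves realise the exchange.\<close>

section \<open>Monomial primes\<close>

text \<open>The ideal generated by the variables of \<open>W\<close>, described term by term;
  \<open>genideal_var\<close> identifies the two inside \<open>poly_ring C\<close>.\<close>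

definition monomial_ideal :: "pos set \<Rightarrow> 'k::field mpoly set" where
  "monomial_ideal W = {p. \<forall>t\<in>Poly_Mapping.keys p. Poly_Mapping.keys t \<inter> W \<noteq> {}}"

lemma keys_add_nat:
  fixes s t :: "'a \<Rightarrow>\<^sub>0 nat"
  shows "Poly_Mapping.keys (s + t) = Poly_Mapping.keys s \<union> Poly_Mapping.keys t"
  by (auto simp: in_keys_iff lookup_add)

lemma sum_monomials:
  "(\<Sum>t\<in>Poly_Mapping.keys p. Poly_Mapping.single t (Poly_Mapping.lookup p t)) = p"
  by (rule poly_mapping_eqI) (auto simp: lookup_sum lookup_single when_def in_keys_iff)

lemma monomial_ideal_add:
  "p \<in> monomial_ideal W \<Longrightarrow> q \<in> monomial_ideal W \<Longrightarrow> p + q \<in> monomial_ideal W"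
  using Poly_Mapping.keys_add[of p q] by (auto simp: monomial_ideal_def)

lemma monomial_ideal_uminus: "p \<in> monomial_ideal W \<Longrightarrow> - p \<in> monomial_ideal W"
  by (auto simp: monomial_ideal_def in_keys_iff)

lemma monomial_ideal_diff:
  "p \<in> monomial_ideal W \<Longrightarrow> q \<in> monomial_ideal W \<Longrightarrow> p - q \<in> monomial_ideal W"
  using monomial_ideal_add[OF _ monomial_ideal_uminus, of p W q] by simp

lemma monomial_ideal_mult_left: "p \<in> monomial_ideal W \<Longrightarrow> q * p \<in> monomial_ideal W"
  using keys_mult[of q p] by (fastforce simp: monomial_ideal_def keys_add_nat)

lemma monomial_ideal_mult_right: "p \<in> monomial_ideal W \<Longrightarrow> p * q \<in> monomial_ideal W"
  using monomial_ideal_mult_left[of p W q] by (simp add: mult.commute)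

lemma var_in_monomial_ideal_iff [simp]: "(var x :: 'k::field mpoly) \<in> monomial_ideal W \<longleftrightarrow> x \<in> W"
  by (simp add: monomial_ideal_def var_def)

text \<open>Dropping every term that involves \<open>W\<close> gives a representative of
  \<open>p\<close> modulo the ideal.\<close>

lemma monomial_ideal_decompose:
  fixes p :: "'k::field mpoly"
  obtains p0 where "p - p0 \<in> monomial_ideal W"
    "\<And>t. t \<in> Poly_Mapping.keys p0 \<Longrightarrow> Poly_Mapping.keys t \<inter> W = {}"
proof -
  define f where "f t = (if Poly_Mapping.keys t \<inter> W = {} then Poly_Mapping.lookup p t else 0)" for t
  have "finite {t. f t \<noteq> 0}"
    by (rule finite_subset[OF _ finite_keys[of p]]) (auto simp: f_def in_keys_iff)
  then have l: "Poly_Mapping.lookup (Abs_poly_mapping f) = f"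
    by simp
  show ?thesis
  proof
    show "p - Abs_poly_mapping f \<in> monomial_ideal W"
      by (auto simp: monomial_ideal_def in_keys_iff lookup_minus l f_def)
    show "Poly_Mapping.keys t \<inter> W = {}" if "t \<in> Poly_Mapping.keys (Abs_poly_mapping f)" for t
      using that by (auto simp: in_keys_iff l f_def split: if_splits)
  qed
qed

text \<open>Otherwise the \<open>W\<close>-free parts \<open>p0\<close> and \<open>q0\<close> are
  nonzero, so their product has some term, again free of \<open>W\<close>; but
  \<open>p0 * q0\<close> is congruent to \<open>p * q\<close> modulo the ideal.\<close>

lemma monomial_ideal_prime:
  fixes p q :: "'k::field mpoly"
  assumes "p * q \<in> monomial_ideal W"
  shows "p \<in> monomial_ideal W \<or> q \<in> monomial_ideal W"
proof (rule ccontr)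
  assume np: "\<not> ?thesis"
  obtain p0 where p0: "p - p0 \<in> monomial_ideal W"
    "\<And>t. t \<in> Poly_Mapping.keys p0 \<Longrightarrow> Poly_Mapping.keys t \<inter> W = {}"
    using monomial_ideal_decompose[of p W] by blast
  obtain q0 where q0: "q - q0 \<in> monomial_ideal W"
    "\<And>t. t \<in> Poly_Mapping.keys q0 \<Longrightarrow> Poly_Mapping.keys t \<inter> W = {}"
    using monomial_ideal_decompose[of q W] by blast
  have "p0 \<noteq> 0" "q0 \<noteq> 0"
    using np p0(1) q0(1) by auto
  then have "p0 * q0 \<noteq> 0"
    by simp
  then obtain t where t: "t \<in> Poly_Mapping.keys (p0 * q0)"
    by (auto simp: poly_mapping_eq_iff fun_eq_iff in_keys_iff)
  have "p0 * q0 = p * q - ((p - p0) * q + p0 * (q - q0))"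
    by (simp add: algebra_simps)
  then have "p0 * q0 \<in> monomial_ideal W"
    using assms p0(1) q0(1)
    by (metis monomial_ideal_add monomial_ideal_diff monomial_ideal_mult_left monomial_ideal_mult_right)
  then have "Poly_Mapping.keys t \<inter> W \<noteq> {}"
    using t by (auto simp: monomial_ideal_def)
  moreover obtain a b where "a \<in> Poly_Mapping.keys p0" "b \<in> Poly_Mapping.keys q0" "t = a + b"
    using t keys_mult[of p0 q0] by blast
  ultimately show False
    using p0(2) q0(2) by (auto simp: keys_add_nat)
qed

lemma one_notin_monomial_ideal: "(1 :: 'k::field mpoly) \<notin> monomial_ideal W"
  by (simp add: monomial_ideal_def)

text \<open>The conditions \<open>x \<noteq> z\<close> and \<open>x \<noteq> w\<close> keep the term
  \<open>var x * var y\<close> from cancelling, and one term free of \<open>W\<close>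
  suffices.\<close>

lemma binomial_notin_monomial_ideal:
  fixes x y z w :: pos
  assumes "x \<notin> W" "y \<notin> W" "x \<noteq> z" "x \<noteq> w"
  shows "(var x * var y - var z * var w :: 'k::field mpoly) \<notin> monomial_ideal W"
proof -
  let ?s = "\<lambda>x. Poly_Mapping.single x (1::nat)"
  have "Poly_Mapping.lookup (?s z + ?s w) x = 0" "Poly_Mapping.lookup (?s x + ?s y) x \<noteq> 0"
    using assms by (simp_all add: lookup_add lookup_single)
  then have "?s z + ?s w \<noteq> ?s x + ?s y"
    by metis
  then have "?s x + ?s y \<in> Poly_Mapping.keys (var x * var y - var z * var w :: 'k mpoly)"
    by (auto simp: var_def mult_single in_keys_iff lookup_minus lookup_single when_def)
  moreover have "Poly_Mapping.keys (?s x + ?s y) \<inter> W = {}"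
    using assms by (auto simp: keys_add_nat)
  ultimately show ?thesis
    unfolding monomial_ideal_def by blast
qed

section \<open>Ideals in the polynomial ring on the vertices of \<open>C\<close>\<close>

lemma poly_ring_simps [simp]:
  "monoid.mult (poly_ring C) = (*)" "one (poly_ring C) = 1"
  "zero (poly_ring C) = 0" "add (poly_ring C) = (+)"
  by (simp_all add: poly_ring_def)

lemma carrier_poly_ring:
  "p \<in> carrier (poly_ring C) \<longleftrightarrow> (\<forall>t\<in>Poly_Mapping.keys p. Poly_Mapping.keys t \<subseteq> Verts C)"
  by (simp add: poly_ring_def)

lemma poly_ring_add_closed:
  "p \<in> carrier (poly_ring C) \<Longrightarrow> q \<in> carrier (poly_ring C) \<Longrightarrow> p + q \<in> carrier (poly_ring C)"
  using Poly_Mapping.keys_add[of p q] by (auto simp: carrier_poly_ring)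

lemma poly_ring_uminus_closed:
  "p \<in> carrier (poly_ring C) \<Longrightarrow> - p \<in> carrier (poly_ring C)"
  by (auto simp: carrier_poly_ring in_keys_iff)

lemma poly_ring_mult_closed:
  "p \<in> carrier (poly_ring C) \<Longrightarrow> q \<in> carrier (poly_ring C) \<Longrightarrow> p * q \<in> carrier (poly_ring C)"
  using keys_mult[of p q] by (fastforce simp: carrier_poly_ring keys_add_nat)

lemma poly_ring_diff_closed:
  "p \<in> carrier (poly_ring C) \<Longrightarrow> q \<in> carrier (poly_ring C) \<Longrightarrow> p - q \<in> carrier (poly_ring C)"
  using poly_ring_add_closed[OF _ poly_ring_uminus_closed, of p C q] by simp

lemma zero_one_in_poly_ring: "0 \<in> carrier (poly_ring C)" "1 \<in> carrier (poly_ring C)"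
  by (simp_all add: carrier_poly_ring)

lemma var_in_poly_ring: "x \<in> Verts C \<Longrightarrow> var x \<in> carrier (poly_ring C)"
  by (simp add: carrier_poly_ring var_def)

lemma cring_poly_ring: "cring (poly_ring C :: 'k::field mpoly ring)"
proof (rule cringI)
  show "abelian_group (poly_ring C :: 'k mpoly ring)"
  proof (rule abelian_groupI)
    fix x :: "'k mpoly" assume "x \<in> carrier (poly_ring C)"
    then show "\<exists>y\<in>carrier (poly_ring C). y \<oplus>\<^bsub>poly_ring C\<^esub> x = \<zero>\<^bsub>poly_ring C\<^esub>"
      by (intro bexI[of _ "- x"]) (auto intro: poly_ring_uminus_closed)
  qed (auto simp: algebra_simps intro: poly_ring_add_closed zero_one_in_poly_ring)
  show "comm_monoid (poly_ring C :: 'k mpoly ring)"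
    by (rule comm_monoidI)
      (auto simp: algebra_simps intro: poly_ring_mult_closed zero_one_in_poly_ring)
qed (auto simp: algebra_simps)

lemma ideal_poly_ring_add:
  "ideal J (poly_ring C) \<Longrightarrow> p \<in> J \<Longrightarrow> q \<in> J \<Longrightarrow> p + q \<in> J"
  using additive_subgroup.a_closed[OF ideal.axioms(1), of J "poly_ring C" p q] by simp

lemma ideal_poly_ring_mult:
  "ideal J (poly_ring C) \<Longrightarrow> p \<in> J \<Longrightarrow> q \<in> carrier (poly_ring C) \<Longrightarrow> q * p \<in> J"
  using ideal.I_l_closed[of J "poly_ring C" p q] by simp

lemma ideal_poly_ring_diff:
  assumes "ideal J (poly_ring C)" "p \<in> J" "q \<in> J"
  shows "p - q \<in> J"
proof -
  have "(- 1) * q \<in> J"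
    using assms by (intro ideal_poly_ring_mult) (auto intro: poly_ring_uminus_closed zero_one_in_poly_ring)
  then show ?thesis
    using ideal_poly_ring_add[OF assms(1,2), of "- q"] by simp
qed

lemma ideal_poly_ring_zero: "ideal J (poly_ring C) \<Longrightarrow> 0 \<in> J"
  using additive_subgroup.zero_closed[OF ideal.axioms(1), of J "poly_ring C"] by simp

lemma primeideal_monomial_ideal:
  "primeideal (monomial_ideal W \<inter> carrier (poly_ring C)) (poly_ring C :: 'k::field mpoly ring)"
proof -
  interpret cring "poly_ring C :: 'k mpoly ring"
    by (rule cring_poly_ring)
  have "subgroup (monomial_ideal W \<inter> carrier (poly_ring C)) (add_monoid (poly_ring C :: 'k mpoly ring))"
  proof (rule group.subgroupI)
    show "group (add_monoid (poly_ring C :: 'k mpoly ring))"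
      by (rule a_group)
    have "0 \<in> monomial_ideal W \<inter> carrier (poly_ring C :: 'k mpoly ring)"
      by (simp add: monomial_ideal_def carrier_poly_ring)
    then show "monomial_ideal W \<inter> carrier (poly_ring C :: 'k mpoly ring) \<noteq> {}"
      by blast
    fix a assume a: "a \<in> monomial_ideal W \<inter> carrier (poly_ring C :: 'k mpoly ring)"
    have "\<ominus>\<^bsub>poly_ring C\<^esub> a = - a"
      using a by (intro minus_equality) (auto intro: poly_ring_uminus_closed)
    then show "inv\<^bsub>add_monoid (poly_ring C)\<^esub> a \<in> monomial_ideal W \<inter> carrier (poly_ring C)"
      using a by (simp add: a_inv_def monomial_ideal_uminus poly_ring_uminus_closed)
  qed (auto intro: monomial_ideal_add poly_ring_add_closed)
  then have "ideal (monomial_ideal W \<inter> carrier (poly_ring C)) (poly_ring C :: 'k mpoly ring)"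
    by (rule idealI[OF ring_axioms])
      (simp_all add: monomial_ideal_mult_left monomial_ideal_mult_right poly_ring_mult_closed)
  then show ?thesis
  proof (rule primeidealI[OF _ cring_axioms])
    show "carrier (poly_ring C :: 'k mpoly ring) \<noteq> monomial_ideal W \<inter> carrier (poly_ring C)"
      using one_notin_monomial_ideal zero_one_in_poly_ring(2) by blast
  qed (auto dest: monomial_ideal_prime)
qed

text \<open>Each term of a polynomial in the monomial ideal is divisible by a variable of
  \<open>W\<close>, and the polynomial is the finite sum of its terms.\<close>

lemma genideal_var:
  assumes "W \<subseteq> Verts C"
  shows "Idl\<^bsub>poly_ring C\<^esub> (var ` W) = (monomial_ideal W \<inter> carrier (poly_ring C) :: 'k::field mpoly set)"
proof -
  interpret cring "poly_ring C :: 'k mpoly ring"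
    by (rule cring_poly_ring)
  have vW: "var ` W \<subseteq> carrier (poly_ring C :: 'k mpoly ring)"
    using assms by (auto intro: var_in_poly_ring)
  note Idl = genideal_ideal[OF vW]
  show ?thesis
  proof
    show "Idl\<^bsub>poly_ring C\<^esub> (var ` W) \<subseteq> (monomial_ideal W \<inter> carrier (poly_ring C) :: 'k mpoly set)"
      using vW by (intro genideal_minimal primeideal.axioms(1) primeideal_monomial_ideal) auto
    show "(monomial_ideal W \<inter> carrier (poly_ring C) :: 'k mpoly set) \<subseteq> Idl\<^bsub>poly_ring C\<^esub> (var ` W)"
    proof
      fix p :: "'k mpoly" assume p: "p \<in> monomial_ideal W \<inter> carrier (poly_ring C)"
      have mono: "Poly_Mapping.single t (Poly_Mapping.lookup p t) \<in> Idl\<^bsub>poly_ring C\<^esub> (var ` W)"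
        if t: "t \<in> Poly_Mapping.keys p" for t
      proof -
        obtain x where x: "x \<in> Poly_Mapping.keys t" "x \<in> W"
          using p t unfolding monomial_ideal_def by blast
        \<comment> \<open>The monomial \<open>t\<close> divided by \<open>x\<close>; truncated
          subtraction is exact because \<open>x\<close> occurs in \<open>t\<close>.\<close>
        define t' where "t' = t - Poly_Mapping.single x 1"
        have "t' + Poly_Mapping.single x 1 = t"
          using x(1) by (intro poly_mapping_eqI)
            (auto simp: t'_def lookup_add lookup_minus lookup_single when_def in_keys_iff)
        then have eq: "Poly_Mapping.single t (Poly_Mapping.lookup p t)
            = Poly_Mapping.single t' (Poly_Mapping.lookup p t) * (var x :: 'k mpoly)"
          by (simp add: var_def mult_single)
        have "Poly_Mapping.keys t' \<subseteq> Poly_Mapping.keys t"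
          by (auto simp: t'_def in_keys_iff lookup_minus)
        then have "Poly_Mapping.single t' (Poly_Mapping.lookup p t) \<in> carrier (poly_ring C)"
          using p t by (auto simp: carrier_poly_ring)
        moreover have "var x \<in> Idl\<^bsub>poly_ring C\<^esub> (var ` W :: 'k mpoly set)"
          using genideal_self[OF vW] x by blast
        ultimately show ?thesis
          unfolding eq by (intro ideal_poly_ring_mult[OF Idl])
      qed
      have "(\<Sum>t\<in>A. Poly_Mapping.single t (Poly_Mapping.lookup p t)) \<in> Idl\<^bsub>poly_ring C\<^esub> (var ` W)"
        if "finite A" "A \<subseteq> Poly_Mapping.keys p" for A
        using that
        by (induction A rule: finite_induct)
          (auto simp: ideal_poly_ring_zero[OF Idl] intro!: ideal_poly_ring_add[OF Idl] mono)
      from this[OF finite_keys order_refl] show "p \<in> Idl\<^bsub>poly_ring C\<^esub> (var ` W)"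
        by (simp add: sum_monomials)
    qed
  qed
qed

text \<open>The only interval of the empty set of minors is \<open>{}\<close>, so its graph has no
  edges and there is no generator.\<close>

lemma cycle_ideal_empty: "cycle_ideal C {} = ({0} :: 'k::field mpoly set)"
proof -
  interpret cring "poly_ring C :: 'k mpoly ring"
    by (rule cring_poly_ring)
  have "\<not> is_cycle {} hs vs" for hs vs
  proof
    assume c: "is_cycle {} hs vs"
    then have "0 < length hs"
      by (auto simp: is_cycle_def)
    with c have "{Inl (hs ! 0), Inr (vs ! 0)} \<in> graph_edges {}"
      unfolding is_cycle_def by blast
    then show False
      by (auto simp: graph_edges_def max_horizontal_def horizontal_interval_def Verts_def)
  qed
  then have "{cyc_poly hs vs :: 'k mpoly | hs vs. is_cycle {} hs vs} = {}"
    by blast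
  moreover have "Idl\<^bsub>poly_ring C\<^esub> {} = ({0} :: 'k mpoly set)"
    using genideal_minimal[OF zeroideal, of "{}"] ideal_poly_ring_zero[OF genideal_ideal[of "{}"]]
    by auto
  ultimately show ?thesis
    by (simp add: cycle_ideal_def)
qed

text \<open>No minor avoids \<open>W\<close>, so the cycle part is zero and only the variables
  remain. This is the only kind of \<open>P_ideal\<close> that the proof evaluates.\<close>

lemma P_ideal_monomial:
  assumes "W \<subseteq> Verts C" "\<And>\<delta>. \<delta> \<in> C \<Longrightarrow> verts \<delta> \<inter> W \<noteq> {}"
  shows "P_ideal C W = (monomial_ideal W \<inter> carrier (poly_ring C) :: 'k::field mpoly set)"
proof -
  have "{\<delta> \<in> C. verts \<delta> \<inter> W = {}} = {}"
    using assms(2) by blast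
  then show ?thesis
    unfolding P_ideal_def by (simp only: genideal_var[OF assms(1)] cycle_ideal_empty) (simp add: set_add_defs)
qed


section \<open>Minimal primes of corner minors\<close>

locale corner_minors =
  fixes C :: "minor set"
  assumes finite_C: "finite C"
    and corner_form: "\<delta> \<in> C \<Longrightarrow> \<exists>a b. \<delta> = Minor 1 a 1 b \<and> 2 \<le> a \<and> 2 \<le> b"
begin

text \<open>The border positions \<open>(a, 1)\<close> and \<open>(1, b)\<close> stand for the vertices of the bipartite graph
  \<open>B\<close>, so that vertex covers and independent sets are sets of positions.\<close>

definition B :: "pos set" where
  "B = {(a, b). Minor 1 a 1 b \<in> C}"

definition border :: "pos set" where
  "border = {x \<in> Verts C. fst x = 1 \<or> snd x = 1}"

text \<open>The corner is excluded because it represents no vertex of \<open>B\<close>.\<close>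

definition indep :: "pos set \<Rightarrow> bool" where
  "indep J \<longleftrightarrow> (1, 1) \<notin> J \<and> (\<forall>(a, b)\<in>B. (a, 1) \<notin> J \<or> (1, b) \<notin> J)"

definition cover :: "pos set \<Rightarrow> bool" where
  "cover T \<longleftrightarrow> (\<forall>(a, b)\<in>B. (a, 1) \<in> T \<or> (1, b) \<in> T)"

text \<open>Some neighbour of the vertex \<open>x\<close> of \<open>B\<close> has a second
  neighbour, so another vertex lies at distance two. The two edges at that neighbour provide the
  binomial in \<open>branching_min_prime_set\<close>.\<close>

definition branching :: "pos \<Rightarrow> bool" where
  "branching x \<longleftrightarrow> (\<exists>a a' c. x = (a, 1) \<and> a \<noteq> a' \<and> (a, c) \<in> B \<and> (a', c) \<in> B) \<or>
     (\<exists>b b' c. x = (1, b) \<and> b \<noteq> b' \<and> (c, b) \<in> B \<and> (c, b') \<in> B)"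

lemma B_ge: "(a, b) \<in> B \<Longrightarrow> 2 \<le> a \<and> 2 \<le> b"
  using corner_form[of "Minor 1 a 1 b"] by (auto simp: B_def)

lemma C_cases:
  assumes "\<delta> \<in> C"
  obtains a b where "\<delta> = Minor 1 a 1 b" "(a, b) \<in> B"
  using corner_form[OF assms] assms by (auto simp: B_def)

lemma Verts_iff:
  "(i, j) \<in> Verts C \<longleftrightarrow> (\<exists>a b. (a, b) \<in> B \<and> (i = 1 \<or> i = a) \<and> (j = 1 \<or> j = b))"
proof
  assume "(i, j) \<in> Verts C"
  then obtain \<delta> where d: "\<delta> \<in> C" "(i, j) \<in> verts \<delta>"
    by (auto simp: Verts_def)
  obtain a b where "\<delta> = Minor 1 a 1 b" "(a, b) \<in> B"
    using d(1) by (rule C_cases)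
  with d(2) show "\<exists>a b. (a, b) \<in> B \<and> (i = 1 \<or> i = a) \<and> (j = 1 \<or> j = b)"
    by (intro exI[of _ a] exI[of _ b]) auto
next
  assume "\<exists>a b. (a, b) \<in> B \<and> (i = 1 \<or> i = a) \<and> (j = 1 \<or> j = b)"
  then show "(i, j) \<in> Verts C"
    by (auto simp: B_def Verts_def intro!: bexI[of _ "Minor 1 _ 1 _"])
qed

lemma finite_Verts: "finite (Verts C)"
proof -
  have "finite (verts \<delta>)" for \<delta>
    by (cases \<delta>) simp
  then show ?thesis
    by (simp add: Verts_def finite_C)
qed

lemma Verts_inner: "(i, j) \<in> Verts C \<Longrightarrow> i \<noteq> 1 \<Longrightarrow> j \<noteq> 1 \<Longrightarrow> (i, j) \<in> B"
  by (auto simp: Verts_iff)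

lemma B_Verts:
  assumes "(a, b) \<in> B"
  shows "(1, 1) \<in> Verts C" "(1, b) \<in> Verts C" "(a, 1) \<in> Verts C" "(a, b) \<in> Verts C"
  using assms by (auto simp: Verts_iff)

lemma Verts_corner: "x \<in> Verts C \<Longrightarrow> (1, 1) \<in> Verts C"
  by (cases x) (auto simp: Verts_iff)

lemma Verts_row_1: "(i, j) \<in> Verts C \<Longrightarrow> (1, j) \<in> Verts C"
  and Verts_col_1: "(i, j) \<in> Verts C \<Longrightarrow> (i, 1) \<in> Verts C"
  by (auto simp: Verts_iff)

lemma minor_in_minor_ideal:
  assumes "(a, b) \<in> B"
  shows "(var (1, 1) * var (a, b) - var (1, b) * var (a, 1) :: 'k::field mpoly) \<in> minor_ideal C"
    and "ideal (minor_ideal C :: 'k mpoly set) (poly_ring C)"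
proof -
  interpret cring "poly_ring C :: 'k mpoly ring"
    by (rule cring_poly_ring)
  have sub: "minor_poly ` C \<subseteq> carrier (poly_ring C :: 'k mpoly ring)"
    by (auto elim!: C_cases simp: B_Verts[unfolded One_nat_def] B_Verts
        intro!: poly_ring_diff_closed poly_ring_mult_closed var_in_poly_ring)
  show "ideal (minor_ideal C :: 'k mpoly set) (poly_ring C)"
    unfolding minor_ideal_def by (rule genideal_ideal[OF sub])
  have "minor_poly (Minor 1 a 1 b) \<in> (minor_ideal C :: 'k mpoly set)"
    unfolding minor_ideal_def using genideal_self[OF sub] assms by (auto simp: B_def)
  then show "(var (1, 1) * var (a, b) - var (1, b) * var (a, 1) :: 'k mpoly) \<in> minor_ideal C"
    by simp
qed

text \<open>A prime below \<open>(W)\<close> containing the minors either contains the corner variable, and then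
  every other variable of \<open>W\<close> by minimality of the cover, or contains every \<open>f\<close> whose multiple by
  the corner variable lies in the ideal of minors.\<close>

lemma min_prime_sets_cover:
  fixes f :: "'k::field mpoly"
  assumes T: "T \<subseteq> border" "(1, 1) \<notin> T" "cover T" "\<And>T'. T' \<subset> T \<Longrightarrow> \<not> cover T'" and "B \<noteq> {}"
    and f: "f \<in> carrier (poly_ring C)" "var (1, 1) * f \<in> minor_ideal C"
      "f \<notin> monomial_ideal (insert (1, 1) T)"
  shows "insert (1, 1) T \<in> min_prime_sets TYPE('k) C"
proof -
  define W where "W = insert (1, 1) T"
  obtain a0 b0 where "(a0, b0) \<in> B"
    using \<open>B \<noteq> {}\<close> by auto
  note s_Verts = B_Verts(1)[OF this] and mi = minor_in_minor_ideal(2)[where ?'k = 'k, OF this]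
  interpret cring "poly_ring C :: 'k mpoly ring"
    by (rule cring_poly_ring)
  let ?M = "monomial_ideal W \<inter> carrier (poly_ring C) :: 'k mpoly set"
  have WV: "W \<subseteq> Verts C"
    using T(1) s_Verts by (auto simp: W_def border_def)
  have "verts \<delta> \<inter> W \<noteq> {}" if "\<delta> \<in> C" for \<delta>
    using that by (auto elim!: C_cases simp: W_def)
  then have P: "P_ideal C W = ?M"
    using P_ideal_monomial[OF WV] by blast
  have "admissible C W"
    unfolding admissible_def
  proof (intro conjI ballI disjI2 WV)
    fix \<delta> assume "\<delta> \<in> C"
    then obtain a b where ab: "\<delta> = Minor 1 a 1 b" "(a, b) \<in> B"
      by (rule C_cases)
    \<comment> \<open>The corner and a border position of a corner minor form one of its edges, so a
      cover together with the corner is admissible.\<close>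
    then have "(a, 1) \<in> T \<or> (1, b) \<in> T"
      using T(3) by (auto simp: cover_def)
    then show "\<exists>e\<in>edges \<delta>. e \<subseteq> W \<inter> verts \<delta>"
      by (auto simp: edges_def ab W_def)
  qed
  moreover have "primeideal ?M (poly_ring C)"
    by (rule primeideal_monomial_ideal)
  moreover have "minor_ideal C \<subseteq> ?M"
    unfolding minor_ideal_def
  proof (rule genideal_minimal)
    show "ideal ?M (poly_ring C)"
      by (rule primeideal.axioms(1)[OF primeideal_monomial_ideal])
    show "minor_poly ` C \<subseteq> ?M"
    proof (rule image_subsetI)
      fix \<delta> assume "\<delta> \<in> C"
      then obtain a b where ab: "\<delta> = Minor 1 a 1 b" "(a, b) \<in> B"
        by (rule C_cases)
      then have "(a, 1) \<in> W \<or> (1, b) \<in> W" "(1, 1) \<in> W"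
        using T(3) by (auto simp: cover_def W_def)
      then show "minor_poly \<delta> \<in> ?M"
        using B_Verts[OF ab(2)] ab(1)
        by (auto intro!: poly_ring_diff_closed poly_ring_mult_closed var_in_poly_ring monomial_ideal_diff
            intro: monomial_ideal_mult_left monomial_ideal_mult_right)
    qed
  qed
  moreover have "\<not> (\<exists>Q. primeideal Q (poly_ring C) \<and> minor_ideal C \<subseteq> Q \<and> Q \<subset> ?M)"
  proof
    assume "\<exists>Q. primeideal Q (poly_ring C) \<and> minor_ideal C \<subseteq> Q \<and> Q \<subset> ?M"
    then obtain Q where Q: "primeideal Q (poly_ring C)" "minor_ideal C \<subseteq> Q" "Q \<subset> ?M"
      by blast
    note Qi = primeideal.axioms(1)[OF Q(1)]
    have prime: "p \<in> Q \<or> q \<in> Q"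
      if "p * q \<in> Q" "p \<in> carrier (poly_ring C)" "q \<in> carrier (poly_ring C)" for p q
      using primeideal.I_prime[OF Q(1), of p q] that by simp
    show False
    proof (cases "var (1, 1) \<in> Q")
      case True
      have "var x \<in> Q" if x: "x \<in> T" for x
      proof -
        \<comment> \<open>By minimality some edge of \<open>B\<close> is covered by \<open>x\<close>
          alone, so exactly one of its two border positions lies in \<open>W\<close>.\<close>
        have "\<not> cover (T - {x})"
          using T(4)[of "T - {x}"] x by blast
        then obtain a b where ab: "(a, b) \<in> B" "(a, 1) \<notin> T - {x}" "(1, b) \<notin> T - {x}"
          by (auto simp: cover_def)
        have "(a, 1) \<in> T \<or> (1, b) \<in> T"
          using ab(1) T(3) by (auto simp: cover_def)
        then have x': "x = (a, 1) \<and> (1, b) \<notin> W \<or> x = (1, b) \<and> (a, 1) \<notin> W"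
          using ab B_ge[OF ab(1)] by (auto simp: W_def)
        have "var (a, b) * var (1, 1) \<in> Q"
          using True B_Verts[OF ab(1)] by (intro ideal_poly_ring_mult[OF Qi]) (auto intro: var_in_poly_ring)
        moreover have "var (1, 1) * var (a, b) - var (1, b) * var (a, 1) \<in> Q"
          using minor_in_minor_ideal(1)[OF ab(1)] Q(2) by blast
        ultimately have "var (a, b) * var (1, 1) - (var (1, 1) * var (a, b) - var (1, b) * var (a, 1)) \<in> Q"
          by (rule ideal_poly_ring_diff[OF Qi])
        \<comment> \<open>Modulo the corner variable the minor reduces to this product. The factor
          outside \<open>W\<close> is not in \<open>Q\<close>, so primality puts
          \<open>var x\<close> into \<open>Q\<close>.\<close>
        then have "var (1, b) * var (a, 1) \<in> Q"
          by (simp add: algebra_simps)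
        then have "var (1, b) \<in> Q \<or> var (a, 1) \<in> Q"
          using B_Verts[OF ab(1)] by (intro prime) (auto intro: var_in_poly_ring)
        moreover have "var y \<notin> Q" if "y \<notin> W" for y
          using Q(3) that var_in_monomial_ideal_iff[where ?'k = 'k, of y W] by blast
        ultimately show ?thesis
          using x' by blast
      qed
      then have "var ` W \<subseteq> Q"
        using True by (auto simp: W_def)
      then have "?M \<subseteq> Q"
        using genideal_minimal[OF Qi, of "var ` W"] genideal_var[OF WV, where ?'k = 'k] by simp
      then show False
        using Q(3) by blast
    next
      case False
      then have "f \<in> Q"
        using prime[of "var (1, 1)" f] f(1,2) Q(2) var_in_poly_ring[OF s_Verts, where ?'a = 'k] by blast
      then show False
        using f(3) Q(3) by (auto simp: W_def)
    qed
  qed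
  ultimately show ?thesis
    unfolding min_prime_sets_def minimal_prime_def using P by (simp add: W_def)
qed

text \<open>The complement of an independent set in the border covers \<open>B\<close>; it shrinks
  to a minimal cover \<open>T\<close>, and \<open>W\<close> is \<open>T\<close> with the corner
  added. Branching supplies the binomial \<open>f\<close> required by
  \<open>min_prime_sets_cover\<close>.\<close>

lemma branching_min_prime_set:
  assumes J: "indep J" "x \<in> J" "branching x"
  obtains W where "W \<in> min_prime_sets TYPE('k::field) C" "W \<noteq> {}" "W \<subseteq> border - J"
proof -
  define T0 where "T0 = border - J - {(1, 1)}"
  have cT0: "cover T0"
    using J(1) B_Verts B_ge by (fastforce simp: cover_def indep_def T0_def border_def)
  have "finite T0"
    using finite_Verts by (auto simp: T0_def border_def intro: finite_subset)
  then have "finite {T. T \<subseteq> T0 \<and> cover T}"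
    by simp
  from finite_has_minimal2[OF this, of T0] obtain T
    where T: "T \<subseteq> T0" "cover T" "\<And>T'. T' \<subset> T \<Longrightarrow> \<not> cover T'"
    using cT0 by (smt (verit) mem_Collect_eq order_refl order_trans psubsetE)
  have xT: "x \<notin> insert (1, 1) T"
    using J T(1) by (auto simp: T0_def indep_def)
  have nT: "(a, b) \<notin> insert (1, 1) T" if "(a, b) \<in> B" for a b
    using T(1) B_ge[OF that] by (auto simp: T0_def border_def)
  have "\<exists>f :: 'k mpoly. f \<in> carrier (poly_ring C) \<and> var (1, 1) * f \<in> minor_ideal C \<and>
      f \<notin> monomial_ideal (insert (1, 1) T)"
    using J(3) unfolding branching_def
  proof (elim disjE exE conjE)
    fix a a' c assume r: "x = (a, 1)" "a \<noteq> a'" "(a, c) \<in> B" "(a', c) \<in> B"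
    note mi = minor_in_minor_ideal(2)[OF r(3), where ?'k = 'k]
    \<comment> \<open>Up to sign, \<open>f\<close> is the 2-minor of the rows \<open>a\<close>,
      \<open>a'\<close> and the columns \<open>1\<close>, \<open>c\<close>; its multiple by the
      corner variable is a combination of two corner minors. Its first term avoids \<open>W\<close>,
      since \<open>x \<in> J\<close> and inner positions are not on the border.\<close>
    define f :: "'k mpoly" where "f = var (a, 1) * var (a', c) - var (a', 1) * var (a, c)"
    have "var (1, 1) * f = var (a, 1) * (var (1, 1) * var (a', c) - var (1, c) * var (a', 1))
        - var (a', 1) * (var (1, 1) * var (a, c) - var (1, c) * var (a, 1))"
      by (simp add: f_def algebra_simps)
    also have "\<dots> \<in> minor_ideal C"
      by (intro ideal_poly_ring_diff[OF mi] ideal_poly_ring_mult[OF mi minor_in_minor_ideal(1)]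
          var_in_poly_ring r B_Verts[OF r(3)] B_Verts[OF r(4)])
    finally have "var (1, 1) * f \<in> minor_ideal C" .
    moreover have "f \<in> carrier (poly_ring C)"
      unfolding f_def using r B_Verts
      by (intro poly_ring_diff_closed poly_ring_mult_closed var_in_poly_ring) blast+
    moreover have "f \<notin> monomial_ideal (insert (1, 1) T)"
      unfolding f_def using r xT nT B_ge[OF r(3)]
      by (intro binomial_notin_monomial_ideal) auto
    ultimately show ?thesis
      by blast
  next
    fix b b' c assume r: "x = (1, b)" "b \<noteq> b'" "(c, b) \<in> B" "(c, b') \<in> B"
    note mi = minor_in_minor_ideal(2)[OF r(3), where ?'k = 'k]
    \<comment> \<open>The same with rows and columns interchanged.\<close>
    define f :: "'k mpoly" where "f = var (1, b) * var (c, b') - var (1, b') * var (c, b)"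
    have "var (1, 1) * f = var (1, b) * (var (1, 1) * var (c, b') - var (1, b') * var (c, 1))
        - var (1, b') * (var (1, 1) * var (c, b) - var (1, b) * var (c, 1))"
      by (simp add: f_def algebra_simps)
    also have "\<dots> \<in> minor_ideal C"
      by (intro ideal_poly_ring_diff[OF mi] ideal_poly_ring_mult[OF mi minor_in_minor_ideal(1)]
          var_in_poly_ring r B_Verts[OF r(3)] B_Verts[OF r(4)])
    finally have "var (1, 1) * f \<in> minor_ideal C" .
    moreover have "f \<in> carrier (poly_ring C)"
      unfolding f_def using r B_Verts
      by (intro poly_ring_diff_closed poly_ring_mult_closed var_in_poly_ring) blast+
    moreover have "f \<notin> monomial_ideal (insert (1, 1) T)"
      unfolding f_def using r xT nT B_ge[OF r(3)]
      by (intro binomial_notin_monomial_ideal) auto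
    ultimately show ?thesis
      by blast
  qed
  then obtain f :: "'k mpoly" where f: "f \<in> carrier (poly_ring C)" "var (1, 1) * f \<in> minor_ideal C"
      "f \<notin> monomial_ideal (insert (1, 1) T)"
    by blast
  have ne: "B \<noteq> {}"
    using J(3) by (auto simp: branching_def)
  then have "(1, 1) \<in> border"
    using B_Verts by (auto simp: border_def)
  then have "insert (1, 1) T \<subseteq> border - J"
    using T(1) J(1) by (auto simp: T0_def indep_def)
  moreover have "insert (1, 1) T \<in> min_prime_sets TYPE('k) C"
    using T f ne by (intro min_prime_sets_cover) (auto simp: T0_def)
  ultimately show thesis
    by (intro that) auto
qed

subsection \<open>Moves along a cycle\<close>

text \<open>As multisets of units, tables split into a part being exchanged and an idle
  remainder.\<close>

definition conn :: "pos multiset \<Rightarrow> pos multiset \<Rightarrow> bool" where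
  "conn M N \<longleftrightarrow> connected_via C (count M) (count N)"

lemma count_in_tables: "count M \<in> tables C \<longleftrightarrow> set_mset M \<subseteq> Verts C"
  by (auto simp: tables_def count_eq_zero_iff)

lemma conn_refl: "set_mset M \<subseteq> Verts C \<Longrightarrow> conn M M"
  by (simp add: conn_def connected_via_def count_in_tables)

lemma connected_via_sym: "connected_via C u v \<Longrightarrow> connected_via C v u"
proof -
  have "(v, u) \<in> adjacent_tables C" if "(u, v) \<in> adjacent_tables C" for u v
  proof -
    obtain b where b: "b \<in> moves C" "(\<lambda>x. int (u x) - int (v x)) = b \<or> (\<lambda>x. int (u x) - int (v x)) = (\<lambda>x. - b x)"
      and uv: "u \<in> tables C" "v \<in> tables C"
      using \<open>(u, v) \<in> adjacent_tables C\<close> unfolding adjacent_tables_def by blast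
    have "(\<forall>x. int (u x) - int (v x) = b x) \<or> (\<forall>x. int (u x) - int (v x) = - b x)"
      using b(2) by (simp only: fun_eq_iff)
    then have "(\<forall>x. int (v x) - int (u x) = b x) \<or> (\<forall>x. int (v x) - int (u x) = - b x)"
      by (smt (verit))
    then have "(\<lambda>x. int (v x) - int (u x)) = b \<or> (\<lambda>x. int (v x) - int (u x)) = (\<lambda>x. - b x)"
      by (simp only: fun_eq_iff)
    with b(1) uv show ?thesis
      unfolding adjacent_tables_def by blast
  qed
  then have "sym (adjacent_tables C)"
    by (auto intro: symI)
  then show "connected_via C u v \<Longrightarrow> connected_via C v u"
    using sym_rtrancl[of "adjacent_tables C"] by (auto simp: connected_via_def dest: symD)
qed

lemma conn_sym: "conn M N \<Longrightarrow> conn N M"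
  unfolding conn_def by (rule connected_via_sym)

lemma conn_trans [trans]: "conn M N \<Longrightarrow> conn N P \<Longrightarrow> conn M P"
  by (auto simp: conn_def connected_via_def)

text \<open>For \<open>a = 1\<close> or \<open>c = 1\<close> the two tables coincide.\<close>

lemma conn_corner:
  assumes "(a, c) \<in> Verts C" "set_mset R \<subseteq> Verts C"
  shows "conn (add_mset (1, 1) (add_mset (a, c) R)) (add_mset (a, 1) (add_mset (1, c) R))"
    (is "conn ?M ?N")
proof -
  have V: "set_mset ?M \<subseteq> Verts C" "set_mset ?N \<subseteq> Verts C"
    using assms Verts_corner[OF assms(1)] Verts_row_1[OF assms(1)] Verts_col_1[OF assms(1)] by simp_all
  show ?thesis
  proof (cases "a = 1 \<or> c = 1")
    case True
    then have "?M = ?N"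
      by (auto simp: add_mset_commute)
    with V(1) show ?thesis
      using conn_refl by metis
  next
    case False
    then have "(a, c) \<in> B"
      using Verts_inner[OF assms(1)] by simp
    then have "move (Minor 1 a 1 c) \<in> moves C"
      unfolding moves_def B_def by (intro imageI) simp
    moreover have "(\<lambda>x. int (count ?M x) - int (count ?N x)) = move (Minor 1 a 1 c)"
      using False by (auto simp: fun_eq_iff unit_vec_def)
    ultimately have "(count ?M, count ?N) \<in> adjacent_tables C"
      using V by (auto simp: adjacent_tables_def count_in_tables)
    then show ?thesis
      using V by (auto simp: conn_def connected_via_def count_in_tables)
  qed
qed

text \<open>One move consumes the corner unit together with \<open>(a, c')\<close>; a reverse move
  restores it while creating \<open>(a, c)\<close>. The spare unit acts as a catalyst.\<close>

lemma conn_exchange: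
  assumes "(a, c) \<in> Verts C" "(a, c') \<in> Verts C" "set_mset R \<subseteq> Verts C"
  shows "conn (add_mset (1, 1) (add_mset (1, c) (add_mset (a, c') R)))
     (add_mset (1, 1) (add_mset (1, c') (add_mset (a, c) R)))"
proof -
  have "conn (add_mset (1, 1) (add_mset (1, c) (add_mset (a, c') R)))
      (add_mset (a, 1) (add_mset (1, c) (add_mset (1, c') R)))"
    using conn_corner[OF assms(2), of "add_mset (1, c) R"] assms Verts_row_1
    by (simp add: add_mset_commute)
  also have "conn \<dots> (add_mset (1, 1) (add_mset (1, c') (add_mset (a, c) R)))"
    using conn_sym[OF conn_corner[OF assms(1), of "add_mset (1, c') R"]] assms Verts_row_1
    by (simp add: add_mset_commute)
  finally show ?thesis .
qed

text \<open>A cycle is encoded by the \<open>r\<close>-periodic sequences of its rows and columns.\<close>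

definition cycle :: "nat \<Rightarrow> (nat \<Rightarrow> nat) \<Rightarrow> (nat \<Rightarrow> nat) \<Rightarrow> bool" where
  "cycle r i j \<longleftrightarrow> 2 \<le> r \<and> (\<forall>k l. i k = i l \<longleftrightarrow> k mod r = l mod r) \<and>
     (\<forall>k l. j k = j l \<longleftrightarrow> k mod r = l mod r) \<and>
     (\<forall>k. (i k, j k) \<in> Verts C \<and> (i (Suc k), j k) \<in> Verts C)"

text \<open>\<open>pos_part\<close> and \<open>neg_part\<close> are the exponent multisets of the
  two monomials of the cycle binomial.\<close>

definition pos_part :: "nat \<Rightarrow> (nat \<Rightarrow> nat) \<Rightarrow> (nat \<Rightarrow> nat) \<Rightarrow> pos multiset" where
  "pos_part r i j = image_mset (\<lambda>k. (i k, j k)) (mset_set {..<r})"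

definition neg_part :: "nat \<Rightarrow> (nat \<Rightarrow> nat) \<Rightarrow> (nat \<Rightarrow> nat) \<Rightarrow> pos multiset" where
  "neg_part r i j = image_mset (\<lambda>k. (i (Suc k), j k)) (mset_set {..<r})"

definition support :: "(nat \<Rightarrow> nat) \<Rightarrow> (nat \<Rightarrow> nat) \<Rightarrow> pos set" where
  "support i j = {x. \<exists>k. x = (i k, j k) \<or> x = (i (Suc k), j k)}"

lemma cycle_Verts: "cycle r i j \<Longrightarrow> (i k, j k) \<in> Verts C" "cycle r i j \<Longrightarrow> (i (Suc k), j k) \<in> Verts C"
  and cycle_row_eq_iff: "cycle r i j \<Longrightarrow> i k = i l \<longleftrightarrow> k mod r = l mod r"
  and cycle_col_eq_iff: "cycle r i j \<Longrightarrow> j k = j l \<longleftrightarrow> k mod r = l mod r"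
  and cycle_ge_2: "cycle r i j \<Longrightarrow> 2 \<le> r"
  by (simp_all add: cycle_def)

lemma support_Verts: "cycle r i j \<Longrightarrow> support i j \<subseteq> Verts C"
  by (auto simp: support_def cycle_Verts)

lemma set_mset_parts: "set_mset (pos_part r i j) \<subseteq> support i j" "set_mset (neg_part r i j) \<subseteq> support i j"
  by (auto simp: pos_part_def neg_part_def support_def)

lemma neq_Suc_mod: "2 \<le> r \<Longrightarrow> Suc k mod r \<noteq> k mod r" for r k :: nat
  by (auto simp: mod_Suc)

text \<open>A spare unit at the corner lets one exchange along the cycle, starting at the first row,
  without ever needing a second one.\<close>

lemma conn_cycle_spare:
  assumes c: "cycle r i j" and "i 0 = 1" and R: "set_mset R \<subseteq> Verts C"
  shows "conn (add_mset (1, 1) (pos_part r i j + R)) (add_mset (1, 1) (neg_part r i j + R))"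
proof -
  \<comment> \<open>Columns before \<open>k\<close> have already moved to the next row, columns
    after \<open>k\<close> have not. The missing unit of column \<open>k\<close> is carried in the
    first row as \<open>(1, j k)\<close>.\<close>
  define X where "X k = image_mset (\<lambda>l. (i (Suc l), j l)) (mset_set {..<k})
      + image_mset (\<lambda>l. (i l, j l)) (mset_set {Suc k..<r}) + R" for k
  have r: "2 \<le> r"
    using c by (rule cycle_ge_2)
  have V: "(i k, j k) \<in> Verts C" "(i (Suc k), j k) \<in> Verts C" for k
    using c by (auto intro: cycle_Verts)
  have "conn (add_mset (1, 1) (pos_part r i j + R)) (add_mset (1, 1) (add_mset (1, j k) (X k)))"
    if "k < r" for k
    using that
  proof (induction k)
    case 0
    have "{..<r} = insert 0 {Suc 0..<r}"
      using r by auto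
    then have "add_mset (1, j 0) (X 0) = pos_part r i j + R"
      using \<open>i 0 = 1\<close> by (simp add: X_def pos_part_def)
    then show ?case
      using R V Verts_corner[OF V(1)] by (auto intro!: conn_refl simp: pos_part_def)
  next
    case (Suc k)
    define Y where "Y = image_mset (\<lambda>l. (i (Suc l), j l)) (mset_set {..<k})
      + image_mset (\<lambda>l. (i l, j l)) (mset_set {Suc (Suc k)..<r}) + R"
    have "{Suc k..<r} = insert (Suc k) {Suc (Suc k)..<r}"
      using Suc.prems by auto
    then have "X k = add_mset (i (Suc k), j (Suc k)) Y"
      by (simp add: X_def Y_def)
    moreover have "X (Suc k) = add_mset (i (Suc k), j k) Y"
      by (simp add: X_def Y_def lessThan_Suc)
    moreover have "set_mset Y \<subseteq> Verts C"
      using R V by (auto simp: Y_def)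
    \<comment> \<open>The carried unit drops to row \<open>i (Suc k)\<close>, its place in
      \<open>neg_part\<close>, while the unit at \<open>(i (Suc k), j (Suc k))\<close> rises to the
      first row.\<close>
    ultimately have "conn (add_mset (1, 1) (add_mset (1, j k) (X k)))
        (add_mset (1, 1) (add_mset (1, j (Suc k)) (X (Suc k))))"
      using conn_exchange[OF V(2)[of k] V(1)[of "Suc k"], of Y] by simp
    with Suc show ?case
      using conn_trans by (meson Suc_lessD)
  qed
  from this[of "r - 1"] r have
    "conn (add_mset (1, 1) (pos_part r i j + R)) (add_mset (1, 1) (add_mset (1, j (r - 1)) (X (r - 1))))"
    by simp
  moreover have "add_mset (1, j (r - 1)) (X (r - 1)) = neg_part r i j + R"
  proof -
    \<comment> \<open>By periodicity the cycle returns to the first row, so the carried unit is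
      already at its final position.\<close>
    have "i r = 1"
      using cycle_row_eq_iff[OF c, of r 0] \<open>i 0 = 1\<close> by simp
    moreover have "{..<r} = insert (r - 1) {..<r - 1}"
      using r by auto
    ultimately show ?thesis
      using r by (simp add: X_def neg_part_def)
  qed
  ultimately show ?thesis
    by simp
qed

section \<open>Tables with enough weight off independent sets\<close>

definition weight :: "pos set \<Rightarrow> pos multiset \<Rightarrow> nat" where
  "weight W M = size (filter_mset (\<lambda>x. x \<in> W) M)"

lemma weight_add: "weight W (M + N) = weight W M + weight W N"
  by (simp add: weight_def)

lemma weight_eq_0: "set_mset M \<inter> W = {} \<Longrightarrow> weight W M = 0"
  by (auto simp: weight_def filter_mset_eq_conv)

lemma weight_sum: "finite W \<Longrightarrow> weight W M = sum (count M) W"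
proof (induction M)
  case (add x M)
  have "sum (count (add_mset x M)) W = (\<Sum>y\<in>W. count M y + (if y = x then 1 else 0))"
    by (intro sum.cong) auto
  also have "\<dots> = sum (count M) W + (if x \<in> W then 1 else 0)"
    using add.prems by (simp add: sum.distrib)
  finally have "sum (count (add_mset x M)) W = sum (count M) W + (if x \<in> W then 1 else 0)" .
  then show ?case
    using add by (simp add: weight_def)
qed (simp add: weight_def)

lemma weight_repeat_mset: "weight W (repeat_mset d M) = d * weight W M"
  by (induction d) (simp_all add: weight_add, simp add: weight_def)

text \<open>The form in which the inequalities over \<open>min_prime_sets\<close> enter the
  combinatorics: by \<open>branching_min_prime_set\<close>, \<open>border - J\<close> contains a
  nonempty member of that family.\<close>

definition heavy :: "pos multiset \<Rightarrow> bool" where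
  "heavy M \<longleftrightarrow> (\<forall>J x. indep J \<longrightarrow> x \<in> J \<longrightarrow> branching x \<longrightarrow> 2 \<le> weight (border - J) M)"

text \<open>Induction on \<open>d\<close>, replacing one copy of \<open>N\<close> in
  \<open>V\<close> by \<open>P\<close> at a time. The weight on a fixed set changes by the same
  amount in every step, so it never falls below the smaller of its values at \<open>V\<close> and
  \<open>U\<close>, and intermediate tables stay heavy.\<close>

lemma conn_interpolate:
  assumes disj: "set_mset P \<inter> set_mset N = {}"
    and step: "\<And>R. set_mset R \<subseteq> S \<Longrightarrow> heavy (P + R) \<Longrightarrow> heavy (N + R) \<Longrightarrow> conn (P + R) (N + R)"
    and S: "set_mset P \<subseteq> S" "S \<subseteq> Verts C"
    and "U + repeat_mset d N = V + repeat_mset d P" "set_mset U \<subseteq> S" "set_mset V \<subseteq> S"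
      "heavy U" "heavy V"
  shows "conn V U"
  using assms(5-)
proof (induction d arbitrary: V)
  case 0
  then show ?case
    using S by (auto intro: conn_refl)
next
  case (Suc d)
  \<comment> \<open>\<open>P\<close> vanishes at the positions of \<open>N\<close>, so the balance
    forces \<open>V\<close> to contain \<open>N\<close> there.\<close>
  have "N \<subseteq># V"
  proof (rule mset_subset_eqI)
    fix x
    have "count U x + Suc d * count N x = count V x + Suc d * count P x"
      using arg_cong[OF Suc.prems(1), of "\<lambda>M. count M x"] by simp
    moreover have "count N x = 0 \<or> count P x = 0"
      using disj by (auto simp: count_eq_zero_iff)
    ultimately show "count N x \<le> count V x"
      by (cases "count N x = 0") simp_all
  qed
  then obtain R where V: "V = N + R"
    by (metis subset_mset.le_iff_add)
  have eq: "U + repeat_mset d N = (P + R) + repeat_mset d P"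
    using Suc.prems(1) by (simp add: V ac_simps)
  have "heavy (P + R)"
    unfolding heavy_def
  proof (intro allI impI)
    fix J x assume J: "indep J" "x \<in> J" "branching x"
    let ?w = "weight (border - J)"
    have "2 \<le> ?w U" "2 \<le> ?w N + ?w R"
      using Suc.prems(4,5) J unfolding heavy_def V weight_add[symmetric] by blast+
    moreover have "?w U + d * ?w N = ?w P + ?w R + d * ?w P"
      using arg_cong[OF eq, of ?w] by (simp add: weight_add weight_repeat_mset)
    \<comment> \<open>If the weight does not decrease towards \<open>U\<close>, compare with
      \<open>V\<close>; otherwise compare with \<open>U\<close>.\<close>
    moreover have "?w N \<le> ?w P \<or> d * ?w P \<le> d * ?w N"
      by (meson linear mult_le_mono2)
    ultimately show "2 \<le> ?w (P + R)"
      unfolding weight_add by linarith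
  qed
  moreover have "set_mset R \<subseteq> S"
    using Suc.prems(3) V by auto
  ultimately have "conn (P + R) U" "conn (P + R) (N + R)"
    using Suc.prems(2,4,5) S(1) by (auto intro!: Suc.IH[OF eq] step simp: V)
  then show ?case
    unfolding V using conn_sym conn_trans by blast
qed

lemma branching_cases:
  assumes "branching (a, b)"
  shows "a \<noteq> 1 \<and> b = 1 \<or> a = 1 \<and> b \<noteq> 1"
  using assms B_ge by (fastforce simp: branching_def)

text \<open>Vertices on the same side of a bipartite graph are never adjacent. If \<open>D\<close>
  contains no suitable branching vertex, it lies on one side, and the vertex \<open>(a, 1)\<close>
  or \<open>(1, b)\<close> of that side can be added.\<close>

lemma indep_extend:
  assumes D: "indep D" "D \<subseteq> {(a, 1), (1, b), (a', 1), (1, b')}"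
    and br: "branching (a, 1)" "branching (1, b)"
    and br': "(a', 1) \<in> D \<Longrightarrow> (1, b') \<in> D \<Longrightarrow> branching (a', 1)"
  obtains J x where "D \<subseteq> J" "indep J" "x \<in> J" "branching x" "x \<in> {(a, 1), (1, b), (a', 1), (1, b')}"
proof -
  consider "(a, 1) \<in> D" | "(1, b) \<in> D" | "(a', 1) \<in> D" "(1, b') \<in> D"
    | "(a, 1) \<notin> D" "(1, b) \<notin> D" "(1, b') \<notin> D" | "(a, 1) \<notin> D" "(1, b) \<notin> D" "(a', 1) \<notin> D"
    by blast
  then show thesis
  proof cases
    case 4
    then have "insert (a, 1) D \<subseteq> {(a, 1), (a', 1)}"
      using D(2) by blast
    then have "indep (insert (a, 1) D)"
      using D(1) branching_cases[OF br(1)] by (auto simp: indep_def dest: B_ge)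
    then show thesis
      using br by (intro that[of _ "(a, 1)"]) auto
  next
    case 5
    then have "insert (1, b) D \<subseteq> {(1, b), (1, b')}"
      using D(2) by blast
    then have "indep (insert (1, b) D)"
      using D(1) branching_cases[OF br(2)] by (auto simp: indep_def dest: B_ge)
    then show thesis
      using br by (intro that[of _ "(1, b)"]) auto
  qed (use D(1) br br' in \<open>auto intro: that[of D]\<close>)
qed

end

section \<open>Cycles through the first row and the first column\<close>

locale marked_cycle = corner_minors +
  fixes r p :: nat and i j :: "nat \<Rightarrow> nat"
  assumes cyc: "cycle r i j" and row_0: "i 0 = 1" and p_less: "p < r" and col_p: "j p = 1"
begin

abbreviation "P \<equiv> pos_part r i j"
abbreviation "N \<equiv> neg_part r i j"

lemma row_eq_1_iff: "i k = 1 \<longleftrightarrow> k mod r = 0"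
  using cycle_row_eq_iff[OF cyc, of k 0] row_0 by simp

lemma col_eq_1_iff: "j k = 1 \<longleftrightarrow> k mod r = p"
  using cycle_col_eq_iff[OF cyc, of k p] col_p p_less by simp

text \<open>Deleting the first row and the first column cuts the cycle into two paths of
  \<open>B\<close>: one from column \<open>j 0\<close> to row \<open>i p\<close>, empty for
  \<open>p = 0\<close>, and one from row \<open>i (Suc p)\<close> to column
  \<open>j (r - 1)\<close>, empty for \<open>p = r - 1\<close>.\<close>

lemma in_B:
  assumes "k < r" "k \<noteq> p"
  shows "k \<noteq> 0 \<Longrightarrow> (i k, j k) \<in> B" and "Suc k < r \<Longrightarrow> (i (Suc k), j k) \<in> B"
  using assms cycle_Verts[OF cyc, of k] row_eq_1_iff[of k] row_eq_1_iff[of "Suc k"] col_eq_1_iff[of k]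
  by (auto intro!: Verts_inner)

lemma row_neq: "k < r \<Longrightarrow> l < r \<Longrightarrow> k \<noteq> l \<Longrightarrow> i k \<noteq> i l"
  and col_neq: "k < r \<Longrightarrow> l < r \<Longrightarrow> k \<noteq> l \<Longrightarrow> j k \<noteq> j l"
  by (simp_all add: cycle_row_eq_iff[OF cyc] cycle_col_eq_iff[OF cyc])

lemma row_r: "i r = 1"
  using row_eq_1_iff[of r] by simp

text \<open>The cycle meets the border only at the ends of the two paths; an empty path contributes
  the corner instead.\<close>

lemma support_border:
  "support i j \<inter> border \<subseteq> {(1, j 0), (i p, 1), (1, j (r - 1)), (i (Suc p), 1)}"
proof
  fix x assume x: "x \<in> support i j \<inter> border"
  then obtain k where k: "x = (i k, j k) \<or> x = (i (Suc k), j k)"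
    by (auto simp: support_def)
  define l where "l = k mod r"
  have l: "l < r"
    using p_less by (simp add: l_def)
  have "i k = i l" "i (Suc k) = i (Suc l)" "j k = j l"
    by (simp_all add: l_def cycle_row_eq_iff[OF cyc] cycle_col_eq_iff[OF cyc] mod_Suc_eq)
  with k have "x = (i l, j l) \<or> x = (i (Suc l), j l)"
    by simp
  moreover have "j l = 1 \<Longrightarrow> l = p"
    using l col_eq_1_iff[of l] by simp
  moreover have "i l = 1 \<Longrightarrow> l = 0"
    using l row_eq_1_iff[of l] by simp
  moreover have "i (Suc l) = 1 \<Longrightarrow> l = r - 1"
    using l row_eq_1_iff[of "Suc l"] by (auto simp: mod_Suc split: if_splits)
  moreover have "fst x = 1 \<or> snd x = 1"
    using x by (auto simp: border_def)
  ultimately show "x \<in> {(1, j 0), (i p, 1), (1, j (r - 1)), (i (Suc p), 1)}"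
    using col_p by auto
qed

text \<open>\<open>P\<close> meets the border only at the indices \<open>0\<close> and
  \<open>p\<close>; these coincide, or \<open>J\<close> removes one of the two positions.\<close>

lemma weight_pos_part_le:
  assumes "p = 0 \<or> (1, j 0) \<in> J \<or> (i p, 1) \<in> J"
  shows "weight (border - J) P \<le> 1"
proof -
  have "{k. k < r \<and> (i k, j k) \<in> border - J} \<subseteq> {0, p} - {k. (i k, j k) \<in> J}"
    by (auto simp: border_def row_eq_1_iff[unfolded One_nat_def] col_eq_1_iff[unfolded One_nat_def])
  also have "\<dots> \<subseteq> (if p = 0 \<or> (1, j 0) \<in> J then {p} else {0})"
    using assms row_0 col_p by auto
  finally have "card {k. k < r \<and> (i k, j k) \<in> border - J} \<le> card (if p = 0 \<or> (1, j 0) \<in> J then {p} else {0})"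
    by (intro card_mono) auto
  also have "\<dots> \<le> 1"
    by simp
  finally show ?thesis
    by (simp add: weight_def pos_part_def filter_mset_image_mset filter_mset_mset_set)
qed

text \<open>The mirror image: \<open>N\<close> meets the border only at the indices
  \<open>r - 1\<close> and \<open>p\<close>.\<close>

lemma weight_neg_part_le:
  assumes "p = r - 1 \<or> (1, j (r - 1)) \<in> J \<or> (i (Suc p), 1) \<in> J"
  shows "weight (border - J) N \<le> 1"
proof -
  have "i (Suc k) = 1 \<Longrightarrow> k < r \<Longrightarrow> k = r - 1" for k
    using row_eq_1_iff[of "Suc k"] by (auto simp: mod_Suc split: if_splits)
  moreover have "j k = 1 \<Longrightarrow> k < r \<Longrightarrow> k = p" for k
    using col_eq_1_iff[of k] by simp
  ultimately have "{k. k < r \<and> (i (Suc k), j k) \<in> border - J} \<subseteq> {r - 1, p} - {k. (i (Suc k), j k) \<in> J}"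
    by (auto simp: border_def)
  also have "\<dots> \<subseteq> (if p = r - 1 \<or> (1, j (r - 1)) \<in> J then {p} else {r - 1})"
    using assms row_r p_less col_p by auto
  finally have "card {k. k < r \<and> (i (Suc k), j k) \<in> border - J}
      \<le> card (if p = r - 1 \<or> (1, j (r - 1)) \<in> J then {p} else {r - 1})"
    by (intro card_mono) auto
  also have "\<dots> \<le> 1"
    by simp
  finally show ?thesis
    by (simp add: weight_def neg_part_def filter_mset_image_mset filter_mset_mset_set)
qed

text \<open>The idle units \<open>R\<close> have no weight off \<open>J\<close>. As an end of one of
  the two paths, \<open>x\<close> removes a border position from \<open>P\<close> or from
  \<open>N\<close>, leaving that part with weight at most one.\<close>

lemma not_heavy:
  assumes J: "set_mset R \<inter> border \<subseteq> J" "indep J" "x \<in> J" "branching x"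
    and x: "x \<in> {(1, j 0), (i p, 1), (1, j (r - 1)), (i (Suc p), 1)}"
  shows "\<not> (heavy (P + R) \<and> heavy (N + R))"
proof
  assume "heavy (P + R) \<and> heavy (N + R)"
  then have "2 \<le> weight (border - J) (P + R)" "2 \<le> weight (border - J) (N + R)"
    using J unfolding heavy_def by blast+
  moreover have "weight (border - J) R = 0"
    using J(1) by (intro weight_eq_0) auto
  ultimately have "2 \<le> weight (border - J) P" "2 \<le> weight (border - J) N"
    by (simp_all add: weight_add)
  then show False
    using weight_pos_part_le[of J] weight_neg_part_le[of J] x J(3) by auto
qed

text \<open>The path from column \<open>j 0\<close> to row \<open>i p\<close> has \<open>p\<close>
  rows and \<open>p\<close> columns, so each end has another vertex at distance two along
  it.\<close>

lemma branching_low: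
  assumes "2 \<le> p"
  shows "branching (i p, 1)" "branching (1, j 0)"
proof -
  obtain q where q: "p = Suc q" "q \<noteq> 0"
    using assms by (cases p) auto
  have "(i p, j q) \<in> B" "(i q, j q) \<in> B" "i p \<noteq> i q"
    using in_B[of q] row_neq[of p q] p_less q by auto
  then show "branching (i p, 1)"
    unfolding branching_def by blast
  have "(i 1, j 0) \<in> B" "(i 1, j 1) \<in> B" "j 0 \<noteq> j 1"
    using in_B(2)[of 0] in_B(1)[of 1] col_neq[of 0 1] p_less assms by auto
  then show "branching (1, j 0)"
    unfolding branching_def by blast
qed

text \<open>The other path has \<open>r - 1 - p\<close> rows and as many columns, again at least two
  of each.\<close>

lemma branching_high:
  assumes "p + 3 \<le> r"
  shows "branching (i (Suc p), 1)" "branching (1, j (r - 1))"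
proof -
  have "(i (Suc p), j (Suc p)) \<in> B" "(i (Suc (Suc p)), j (Suc p)) \<in> B" "i (Suc p) \<noteq> i (Suc (Suc p))"
    using in_B[of "Suc p"] row_neq[of "Suc p" "Suc (Suc p)"] assms by auto
  then show "branching (i (Suc p), 1)"
    unfolding branching_def by blast
  obtain q where q: "r = Suc (Suc q)" "p < q"
    using assms by (intro that[of "r - 2"]) auto
  have "(i (Suc q), j (Suc q)) \<in> B" "(i (Suc q), j q) \<in> B" "j (Suc q) \<noteq> j q"
    using in_B(2)[of q] in_B(1)[of "Suc q"] col_neq[of q "Suc q"] q by auto
  then show "branching (1, j (r - 1))"
    unfolding branching_def q(1) diff_Suc_1 by blast
qed

text \<open>Both paths have at most one edge, so the cycle comes from a single corner minor or, for
  \<open>r = 3\<close>, from two that share the corner.\<close>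

lemma conn_short:
  assumes R: "set_mset R \<subseteq> Verts C" and p: "p < 2" "r < p + 3"
  shows "conn (P + R) (N + R)"
proof -
  have V: "(i k, j k) \<in> Verts C" "(i (Suc k), j k) \<in> Verts C" for k
    using cycle_Verts[OF cyc] by blast+
  have r: "2 \<le> r"
    using cyc by (rule cycle_ge_2)
  consider "r = 2" "p = 0" | "r = 2" "p = 1" | "r = 3" "p = 1"
    using p r by linarith
  then show ?thesis
  proof cases
    case 1
    then have "P + R = add_mset (1, 1) (add_mset (i 1, j 1) R)" "N + R = add_mset (i 1, 1) (add_mset (1, j 1) R)"
      using row_0 col_p row_r by (simp_all add: pos_part_def neg_part_def numeral_2_eq_2 lessThan_Suc add_mset_commute)
    then show ?thesis
      using conn_corner[OF V(1)[of 1] R] by (simp only:)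
  next
    case 2
    then have "N + R = add_mset (1, 1) (add_mset (i 1, j 0) R)" "P + R = add_mset (i 1, 1) (add_mset (1, j 0) R)"
      using row_0 col_p row_r by (simp_all add: pos_part_def neg_part_def numeral_2_eq_2 lessThan_Suc add_mset_commute)
    then show ?thesis
      using conn_sym[OF conn_corner[OF V(2)[of 0] R]] by (simp only: One_nat_def)
  next
    case 3
    have eqs: "P + R = add_mset (i 1, 1) (add_mset (1, j 0) (add_mset (i 2, j 2) R))"
      "N + R = add_mset (i 2, 1) (add_mset (1, j 2) (add_mset (i 1, j 0) R))"
      using row_0 col_p row_r 3
      by (simp_all add: pos_part_def neg_part_def numeral_2_eq_2 numeral_3_eq_3 lessThan_Suc add_mset_commute)
    \<comment> \<open>The edge \<open>(i 1, j 0)\<close> produces a corner unit, which the edge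
      \<open>(i 2, j 2)\<close> then consumes.\<close>
    have "conn (P + R) (add_mset (1, 1) (add_mset (i 1, j 0) (add_mset (i 2, j 2) R)))"
      unfolding eqs using V[of 0] V[of 2] R by (intro conn_sym[OF conn_corner]) auto
    also have "conn \<dots> (add_mset (i 2, 1) (add_mset (1, j 2) (add_mset (i 1, j 0) R)))"
      using conn_corner[OF V(1)[of 2], of "add_mset (i 1, j 0) R"] V[of 0] R
      by (simp add: add_mset_commute)
    finally show ?thesis
      unfolding eqs .
  qed
qed

text \<open>If the exchange failed, the border positions occupied by \<open>R\<close> would form an
  independent set \<open>D\<close> among the path ends. An independent set containing
  \<open>D\<close> and a branching end then contradicts \<open>not_heavy\<close>, unless both paths
  are so short that \<open>conn_short\<close> applies.\<close>

lemma conn_step: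
  assumes R: "set_mset R \<subseteq> support i j" and heavy: "heavy (P + R)" "heavy (N + R)"
  shows "conn (P + R) (N + R)"
proof (rule ccontr)
  assume nconn: "\<not> conn (P + R) (N + R)"
  have RV: "set_mset R \<subseteq> Verts C"
    using R support_Verts[OF cyc] by blast
  have PNV: "set_mset P \<subseteq> Verts C" "set_mset N \<subseteq> Verts C"
    using set_mset_parts support_Verts[OF cyc] by blast+
  define D where "D = set_mset R \<inter> border"
  have D: "D \<subseteq> {(1, j 0), (i p, 1), (1, j (r - 1)), (i (Suc p), 1)}"
    using support_border R by (auto simp: D_def)
  have "(1, 1) \<notin># R"
  proof
    assume "(1, 1) \<in># R"
    then obtain R' where "R = add_mset (1, 1) R'"
      by (rule mset_add)
    then show False
      using conn_cycle_spare[OF cyc row_0, of R'] RV nconn by simp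
  qed
  \<comment> \<open>Units of \<open>R\<close> at both border positions of an edge of
    \<open>B\<close> could be turned into a corner unit by one move and restored after the
    exchange.\<close>
  moreover have "(a, 1) \<notin># R \<or> (1, b) \<notin># R" if ab: "(a, b) \<in> B" for a b
  proof (rule ccontr)
    assume "\<not> ?thesis"
    then have *: "(a, 1) \<in># R" "(1, b) \<in># R"
      by auto
    obtain R1 where R1: "R = add_mset (a, 1) R1"
      using *(1) by (rule mset_add)
    moreover have "(1, b) \<in># R1"
      using *(2) R1 B_ge[OF ab] by auto
    then obtain R' where "R1 = add_mset (1, b) R'"
      by (rule mset_add)
    ultimately have R': "R = add_mset (a, 1) (add_mset (1, b) R')"
      by simp
    have *: "conn (add_mset (1, 1) (M + add_mset (a, b) R')) (M + R)" if "set_mset M \<subseteq> Verts C" for M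
      using conn_corner[OF B_Verts(4)[OF ab], of "M + R'"] that RV R' by simp
    have "conn (P + R) (add_mset (1, 1) (P + add_mset (a, b) R'))"
      using *[OF PNV(1)] by (rule conn_sym)
    also have "conn \<dots> (add_mset (1, 1) (N + add_mset (a, b) R'))"
      using RV R' B_Verts(4)[OF ab] by (intro conn_cycle_spare[OF cyc row_0]) auto
    also have "conn \<dots> (N + R)"
      using *[OF PNV(2)] .
    finally show False
      using nconn by simp
  qed
  ultimately have indep: "indep D"
    by (auto simp: indep_def D_def)
  have not1: "i (Suc p) \<noteq> 1" if "(i (Suc p), 1) \<in> D"
    using that \<open>(1, 1) \<notin># R\<close> by (auto simp: D_def)
  have not1': "i p \<noteq> 1" if "(i p, 1) \<in> D"
    using that \<open>(1, 1) \<notin># R\<close> by (auto simp: D_def)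
  have nadj: "(a, b) \<notin> B" if "(a, 1) \<in> D" "(1, b) \<in> D" for a b
    using indep that by (auto simp: indep_def)
  consider "2 \<le> p" | "p + 3 \<le> r" | "p < 2" "r < p + 3"
    by linarith
  then obtain J x where "D \<subseteq> J" "indep J" "x \<in> J" "branching x"
    "x \<in> {(1, j 0), (i p, 1), (1, j (r - 1)), (i (Suc p), 1)}"
  proof cases
    case 1
    \<comment> \<open>If \<open>D\<close> contains both ends of the other path, they differ from the
      corner, so that path is nonempty, and they are not adjacent, so it has more than one edge and
      its ends branch.\<close>
    have "branching (i (Suc p), 1)" if A: "(i (Suc p), 1) \<in> D" "(1, j (r - 1)) \<in> D"
    proof -
      have "Suc p \<noteq> r"
        using not1[OF A(1)] row_r by auto
      moreover have "Suc (Suc p) \<noteq> r"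
        using nadj[OF A] in_B(1)[of "Suc p"] by auto
      ultimately show ?thesis
        using p_less by (intro branching_high) simp
    qed
    then show thesis
      using indep_extend[OF indep, of "i p" "j 0" "i (Suc p)" "j (r - 1)"] D branching_low[OF 1]
      by (smt (verit) insert_commute that)
  next
    case 2
    have "branching (i p, 1)" if A: "(i p, 1) \<in> D" "(1, j 0) \<in> D"
    proof -
      have "p \<noteq> 0"
        using not1'[OF A(1)] row_0 by metis
      moreover have "p \<noteq> 1"
        using nadj[OF A] in_B(2)[of 0] 2 by auto
      ultimately show ?thesis
        by (intro branching_low) simp
    qed
    then show thesis
      using indep_extend[OF indep, of "i (Suc p)" "j (r - 1)" "i p" "j 0"] D branching_high[OF 2]
      by (smt (verit) insert_commute that)
  next
    case 3
    then show thesis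
      using conn_short[OF RV] nconn by blast
  qed
  then show False
    using not_heavy[of R J x] heavy by (simp add: D_def)
qed

lemma count_pos_part: "count P (i k, j k) = 1" "x \<notin> {(i k, j k) |k. True} \<Longrightarrow> count P x = 0"
  and count_neg_part: "count N (i (Suc k), j k) = 1" "x \<notin> {(i (Suc k), j k) |k. True} \<Longrightarrow> count N x = 0"
proof -
  have mod_r: "(i k, j k) = (i (k mod r), j (k mod r))" "(i (Suc k), j k) = (i (Suc (k mod r)), j (k mod r))" for k
    by (simp_all add: cycle_row_eq_iff[OF cyc] cycle_col_eq_iff[OF cyc] mod_Suc_eq)
  have "inj_on (\<lambda>k. (i k, j k)) {..<r}" "inj_on (\<lambda>k. (i (Suc k), j k)) {..<r}"
    using col_neq by (auto simp: inj_on_def)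
  then have eqs: "P = mset_set ((\<lambda>k. (i k, j k)) ` {..<r})" "N = mset_set ((\<lambda>k. (i (Suc k), j k)) ` {..<r})"
    by (simp_all add: pos_part_def neg_part_def image_mset_mset_set)
  have "k mod r < r"
    using p_less by simp
  then show "count P (i k, j k) = 1" "count N (i (Suc k), j k) = 1"
    using mod_r[of k] by (auto simp: eqs)
  show "x \<notin> {(i k, j k) |k. True} \<Longrightarrow> count P x = 0" "x \<notin> {(i (Suc k), j k) |k. True} \<Longrightarrow> count N x = 0"
    by (auto simp: eqs count_mset_set')
qed

lemma pos_neg_neq: "(i k, j k) \<noteq> (i (Suc l), j l)"
proof
  assume "(i k, j k) = (i (Suc l), j l)"
  then have "k mod r = l mod r" "k mod r = Suc l mod r"
    using cycle_row_eq_iff[OF cyc] cycle_col_eq_iff[OF cyc] by auto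
  then show False
    using neq_Suc_mod[OF cycle_ge_2[OF cyc], of l] by simp
qed

lemma conn_multiple:
  assumes "set_mset U \<subseteq> support i j" "set_mset V \<subseteq> support i j" "heavy U" "heavy V"
    and eq: "\<And>k. count U (i k, j k) = count V (i k, j k) + d"
      "\<And>k. count U (i (Suc k), j k) + d = count V (i (Suc k), j k)"
  shows "conn V U"
proof (rule conn_interpolate)
  show "set_mset P \<inter> set_mset N = {}"
    using pos_neg_neq by (auto simp: pos_part_def neg_part_def)
  show "U + repeat_mset d N = V + repeat_mset d P"
  proof (rule multiset_eqI)
    fix x
    consider k where "x = (i k, j k)" | k where "x = (i (Suc k), j k)" | "x \<notin> support i j"
      by (auto simp: support_def)
    then show "count (U + repeat_mset d N) x = count (V + repeat_mset d P) x"
    proof cases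
      case (1 k)
      then have "count N x = 0"
        using count_neg_part(2)[of x] pos_neg_neq by auto
      then show ?thesis
        using eq(1)[of k] count_pos_part(1)[of k] 1 by simp
    next
      case (2 k)
      have "x \<noteq> (i l, j l)" for l
        unfolding 2 by (rule pos_neg_neq[symmetric])
      then have "count P x = 0"
        using count_pos_part(2)[of x] by blast
      then show ?thesis
        using eq(2)[of k] count_neg_part(1)[of k] 2 by simp
    next
      case 3
      then have "x \<notin># P" "x \<notin># N" "x \<notin># U" "x \<notin># V"
        using set_mset_parts[of r i j] assms(1,2) by blast+
      then show ?thesis
        by (simp add: not_in_iff)
    qed
  qed
qed (use assms set_mset_parts support_Verts[OF cyc] conn_step in auto)

end

section \<open>From arbitrary cycles to cycles through the first row and column\<close>

context corner_minors
begin

text \<open>If the cycle avoids the first row, its border positions all lie in the first column.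
  Then \<open>J\<close>, the whole side of row vertices, is independent and \<open>U\<close> has no
  weight off it. A branching vertex exists because two consecutive rows of the cycle share a column
  other than the first. Columns are treated likewise.\<close>

lemma cycle_border:
  assumes c: "cycle r i j" and U: "set_mset U \<subseteq> support i j" "heavy U"
  shows "\<exists>k. i k = 1" and "\<exists>k. j k = 1"
proof -
  have neq: "i k \<noteq> i (Suc k)" "j k \<noteq> j (Suc k)" for k
    using neq_Suc_mod[OF cycle_ge_2[OF c], of k] by (simp_all add: cycle_row_eq_iff[OF c] cycle_col_eq_iff[OF c])
  show "\<exists>k. i k = 1"
  proof (rule ccontr)
    assume "\<not> ?thesis"
    then have no: "i k \<noteq> 1" for k
      by blast
    define J where "J = {x :: pos. snd x = 1 \<and> fst x \<noteq> 1}"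
    obtain k where k: "j k \<noteq> 1"
      using neq(2)[of 0] by metis
    have "(i k, j k) \<in> B" "(i (Suc k), j k) \<in> B"
      using k no cycle_Verts[OF c] by (auto intro!: Verts_inner)
    then have "branching (i k, 1)"
      using neq(1)[of k] unfolding branching_def by blast
    moreover have "(i k, 1) \<in> J"
      using no by (simp add: J_def)
    moreover have "indep J"
      using B_ge by (auto simp: indep_def J_def)
    ultimately have "2 \<le> weight (border - J) U"
      using U(2) unfolding heavy_def by blast
    moreover have "set_mset U \<inter> (border - J) = {}"
      using U(1) no by (auto simp: support_def border_def J_def)
    ultimately show False
      using weight_eq_0 by fastforce
  qed
  show "\<exists>k. j k = 1"
  proof (rule ccontr)
    assume "\<not> ?thesis"
    then have no: "j k \<noteq> 1" for k
      by blast
    define J where "J = {x :: pos. fst x = 1 \<and> snd x \<noteq> 1}"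
    obtain k where k: "i (Suc k) \<noteq> 1"
      using neq(1)[of "Suc 0"] by metis
    have "(i (Suc k), j k) \<in> B" "(i (Suc k), j (Suc k)) \<in> B"
      using k no cycle_Verts[OF c] by (auto intro!: Verts_inner)
    then have "branching (1, j k)"
      using neq(2)[of k] unfolding branching_def by blast
    moreover have "(1, j k) \<in> J"
      using no by (simp add: J_def)
    moreover have "indep J"
      using B_ge by (auto simp: indep_def J_def)
    ultimately have "2 \<le> weight (border - J) U"
      using U(2) unfolding heavy_def by blast
    moreover have "set_mset U \<inter> (border - J) = {}"
      using U(1) no by (auto simp: support_def border_def J_def)
    ultimately show False
      using weight_eq_0 by fastforce
  qed
qed

lemma cycle_shift:
  assumes c: "cycle r i j"
  shows "cycle r (\<lambda>k. i (k + q)) (\<lambda>k. j (k + q))"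
    and "support (\<lambda>k. i (k + q)) (\<lambda>k. j (k + q)) = support i j"
proof -
  have "(k + q) mod r = (l + q) mod r \<longleftrightarrow> k mod r = l mod r" for k l
  proof -
    have "(k + q) mod r = (l + q) mod r \<longleftrightarrow> int ((k + q) mod r) = int ((l + q) mod r)"
      by simp
    also have "\<dots> \<longleftrightarrow> int (k mod r) = int (l mod r)"
      unfolding zmod_int by (simp add: mod_eq_dvd_iff)
    finally show ?thesis
      by simp
  qed
  then show "cycle r (\<lambda>k. i (k + q)) (\<lambda>k. j (k + q))"
    using c by (simp add: cycle_def)
  have period: "i (k + r * q) = i k" "j (k + r * q) = j k" for k
    by (simp_all add: cycle_row_eq_iff[OF c] cycle_col_eq_iff[OF c])
  have "\<exists>l. i k = i (l + q) \<and> i (Suc k) = i (Suc l + q) \<and> j k = j (l + q)" for k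
  proof -
    \<comment> \<open>Shifting back by \<open>q\<close> is done by adding \<open>r' * q\<close>,
      which is congruent to \<open>- q\<close> modulo \<open>r\<close> and keeps indices
      natural.\<close>
    obtain r' where "r = Suc r'"
      using cycle_ge_2[OF c] by (cases r) auto
    then have "k + r * q = k + r' * q + q" "Suc k + r * q = Suc (k + r' * q) + q"
      by simp_all
    then show ?thesis
      using period[of k] period(1)[of "Suc k"] by metis
  qed
  then show "support (\<lambda>k. i (k + q)) (\<lambda>k. j (k + q)) = support i j"
    by (auto simp: support_def)
qed

text \<open>Used for a row or column \<open>A\<close>, which meets the cycle in two positions only,
  so equal line sums make the two differences cancel.\<close>

lemma sum_diff_eq_0:
  assumes "finite A" "weight A U = weight A V"
    and "\<And>z. z \<in> A \<Longrightarrow> z \<in># U \<or> z \<in># V \<Longrightarrow> z = x \<or> z = y" "x \<in> A" "y \<in> A" "x \<noteq> y"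
  shows "int (count U x) - int (count V x) + (int (count U y) - int (count V y)) = 0"
proof -
  have "z \<notin># U \<and> z \<notin># V" if "z \<in> A - {x, y}" for z
    using assms(3)[of z] that by blast
  then have "(\<Sum>z\<in>A. int (count U z) - int (count V z)) = (\<Sum>z\<in>{x, y}. int (count U z) - int (count V z))"
    using assms(1,4,5) by (intro sum.mono_neutral_right) (auto simp: not_in_iff)
  moreover have "(\<Sum>z\<in>A. int (count U z) - int (count V z)) = int (weight A U) - int (weight A V)"
    using assms(1) by (simp add: weight_sum sum_subtractf)
  ultimately show ?thesis
    using assms(2,6) by simp
qed

text \<open>Each row and each column of the cycle contains two of its positions, so
  \<open>U - V\<close> alternates between a constant \<open>d\<close> and \<open>- d\<close> around
  it. Once the cycle is rotated to start in the first row, \<open>conn_multiple\<close>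
  applies.\<close>

lemma conn_cycle:
  assumes c: "cycle r i j"
    and U: "set_mset U \<subseteq> support i j" "heavy U" and V: "set_mset V \<subseteq> support i j" "heavy V"
    and row: "\<And>x. x \<in> Verts C \<Longrightarrow> weight {y \<in> Verts C. fst y = fst x} U = weight {y \<in> Verts C. fst y = fst x} V"
    and col: "\<And>x. x \<in> Verts C \<Longrightarrow> weight {y \<in> Verts C. snd y = snd x} U = weight {y \<in> Verts C. snd y = snd x} V"
  shows "conn U V"
proof -
  obtain q where q: "i q = 1"
    using cycle_border(1)[OF c U] by blast
  define i' j' where "i' k = i (k + q)" and "j' k = j (k + q)" for k
  have c': "cycle r i' j'" and supp: "support i' j' = support i j"
    using cycle_shift[OF c, of q] by (simp_all add: i'_def[abs_def] j'_def[abs_def])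
  obtain k where "j' k = 1"
    using cycle_border(2)[OF c', of U] U supp by auto
  then have "j' (k mod r) = 1"
    using cycle_col_eq_iff[OF c', of "k mod r" k] by simp
  then interpret marked_cycle C r "k mod r" i' j'
    using c' q cycle_ge_2[OF c] by unfold_locales (auto simp: i'_def)
  define D where "D x = int (count U x) - int (count V x)" for x
  have supp_cases: "\<exists>k. x = (i' k, j' k) \<or> x = (i' (Suc k), j' k)" if "x \<in># U \<or> x \<in># V" for x
    using that U(1) V(1) supp by (auto simp: support_def)
  have mod_Suc_cong: "Suc k mod r = Suc l mod r" if "k mod r = l mod r" for k l
    using that by (metis mod_Suc_eq)
  have mod_Suc_inj: "k mod r = l mod r" if "Suc k mod r = Suc l mod r" for k l
    using that cycle_ge_2[OF c] by (auto simp: mod_Suc split: if_splits)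
  have "D (i' k, j' k) + D (i' (Suc k), j' k) = 0" for k
    unfolding D_def
  proof (rule sum_diff_eq_0)
    show "weight {y \<in> Verts C. snd y = snd (i' k, j' k)} U = weight {y \<in> Verts C. snd y = snd (i' k, j' k)} V"
      by (intro col cycle_Verts[OF c'])
    fix z assume z: "z \<in> {y \<in> Verts C. snd y = snd (i' k, j' k)}" "z \<in># U \<or> z \<in># V"
    then obtain l where l: "z = (i' l, j' l) \<or> z = (i' (Suc l), j' l)"
      using supp_cases by blast
    with z have "k mod r = l mod r"
      using cycle_col_eq_iff[OF c', of k l] by auto
    then have "i' l = i' k" "i' (Suc l) = i' (Suc k)" "j' l = j' k"
      using mod_Suc_cong[of k l] by (simp_all add: cycle_row_eq_iff[OF c'] cycle_col_eq_iff[OF c'])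
    then show "z = (i' k, j' k) \<or> z = (i' (Suc k), j' k)"
      using l by simp
  qed (use pos_neg_neq finite_Verts cycle_Verts[OF c'] in auto)
  then have neg: "D (i' (Suc k), j' k) = - D (i' k, j' k)" for k
    by (metis add.commute eq_neg_iff_add_eq_0)
  have "D (i' (Suc k), j' k) + D (i' (Suc k), j' (Suc k)) = 0" for k
    unfolding D_def
  proof (rule sum_diff_eq_0)
    show "weight {y \<in> Verts C. fst y = fst (i' (Suc k), j' k)} U
        = weight {y \<in> Verts C. fst y = fst (i' (Suc k), j' k)} V"
      by (intro row cycle_Verts[OF c'])
    fix z assume z: "z \<in> {y \<in> Verts C. fst y = fst (i' (Suc k), j' k)}" "z \<in># U \<or> z \<in># V"
    then obtain l where l: "z = (i' l, j' l) \<or> z = (i' (Suc l), j' l)"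
      using supp_cases by blast
    have "j' l = j' (Suc k)" if "i' l = i' (Suc k)"
      using that by (simp add: cycle_row_eq_iff[OF c'] cycle_col_eq_iff[OF c'])
    moreover have "j' l = j' k" if "i' (Suc l) = i' (Suc k)"
      using that mod_Suc_inj[of l k] by (simp add: cycle_row_eq_iff[OF c'] cycle_col_eq_iff[OF c'])
    ultimately show "z = (i' (Suc k), j' k) \<or> z = (i' (Suc k), j' (Suc k))"
      using l z(1) by (elim disjE) simp_all
  next
    show "(i' (Suc k), j' k) \<noteq> (i' (Suc k), j' (Suc k))"
      using pos_neg_neq[of "Suc k" k] by auto
  qed (use finite_Verts cycle_Verts[OF c'] in auto)
  then have "D (i' (Suc k), j' (Suc k)) = D (i' k, j' k)" for k
    using neg[of k] by (metis add_eq_0_iff minus_minus)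
  then have const: "D (i' k, j' k) = D (i' 0, j' 0)" for k
    by (induction k) simp_all
  define d where "d = D (i' 0, j' 0)"
  have D: "D (i' k, j' k) = d" "D (i' (Suc k), j' k) = - d" for k
    using const[of k] neg[of k] by (simp_all add: d_def)
  show ?thesis
  \<comment> \<open>The sign of \<open>d\<close> decides which table has the surplus on
    \<open>P\<close>.\<close>
  proof (cases "0 \<le> d")
    case True
    have "conn V U"
    proof (rule conn_multiple)
      show "count U (i' k, j' k) = count V (i' k, j' k) + nat d"
        "count U (i' (Suc k), j' k) + nat d = count V (i' (Suc k), j' k)" for k
        using D[of k] True by (simp_all add: D_def)
    qed (use U V supp in auto)
    then show ?thesis
      by (rule conn_sym)
  next
    case False
    show ?thesis
    proof (rule conn_multiple)
      show "count V (i' k, j' k) = count U (i' k, j' k) + nat (- d)"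
        "count V (i' (Suc k), j' k) + nat (- d) = count U (i' (Suc k), j' k)" for k
        using D[of k] False by (simp_all add: D_def)
    qed (use U V supp in auto)
  qed
qed

section \<open>Maximal intervals as full rows and columns\<close>

lemma joined_sym: "joined E x y \<Longrightarrow> joined E y x"
proof -
  have "sym {(u, v). {u, v} \<in> E}"
    by (auto simp: sym_def insert_commute)
  then show "joined E x y \<Longrightarrow> joined E y x"
    unfolding joined_def by (meson sym_rtrancl symD)
qed

lemma joined_trans: "joined E x y \<Longrightarrow> joined E y z \<Longrightarrow> joined E x z"
  unfolding joined_def by (rule rtrancl_trans)

lemma joined_edge: "{x, y} \<in> E \<Longrightarrow> joined E x y"
  unfolding joined_def by auto

text \<open>Every vertex belongs to a corner minor, whose edges reach the first column and the first
  row in at most one step.\<close>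

lemma joined_border:
  assumes "(i, j) \<in> Verts C"
  shows "joined (\<Union>\<delta>\<in>C. hedges \<delta>) (i, j) (i, 1)" and "joined (\<Union>\<delta>\<in>C. vedges \<delta>) (i, j) (1, j)"
proof -
  obtain a b where ab: "Minor 1 a 1 b \<in> C" "i = 1 \<or> i = a" "j = 1 \<or> j = b"
    using assms unfolding Verts_iff B_def by blast
  have "j = 1 \<or> {(i, j), (i, 1)} \<in> hedges (Minor 1 a 1 b)" "i = 1 \<or> {(i, j), (1, j)} \<in> vedges (Minor 1 a 1 b)"
    using ab(2,3) by auto
  moreover have "joined E x x" for E x
    by (simp add: joined_def)
  ultimately show "joined (\<Union>\<delta>\<in>C. hedges \<delta>) (i, j) (i, 1)" "joined (\<Union>\<delta>\<in>C. vedges \<delta>) (i, j) (1, j)"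
    using joined_edge UN_I[OF ab(1)] by metis+
qed

text \<open>Any two vertices of a row are joined through its position in the first column, so the
  whole row is an interval and maximality makes \<open>H\<close> all of it.\<close>

lemma max_horizontal_row:
  assumes "H \<in> max_horizontal C"
  shows "\<exists>i. H = {x \<in> Verts C. fst x = i}"
proof -
  obtain i where i: "\<forall>x\<in>H. fst x = i" "H \<subseteq> Verts C"
    using assms by (auto simp: max_horizontal_def horizontal_interval_def)
  let ?R = "{x \<in> Verts C. fst x = i}"
  have "horizontal_interval C ?R"
    unfolding horizontal_interval_def
  proof (intro conjI ballI)
    fix x y assume "x \<in> ?R" "y \<in> ?R"
    then have *: "x = (i, snd x)" "y = (i, snd y)" "x \<in> Verts C" "y \<in> Verts C"
      by (auto simp: prod_eq_iff)
    then show "joined (\<Union>\<delta>\<in>C. hedges \<delta>) x y"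
      using joined_trans[OF joined_border(1) joined_sym[OF joined_border(1)]] by metis
  qed auto
  moreover have "H \<subseteq> ?R"
    using i by auto
  ultimately show ?thesis
    using assms by (auto simp: max_horizontal_def)
qed

lemma max_vertical_col:
  assumes "H \<in> max_vertical C"
  shows "\<exists>j. H = {x \<in> Verts C. snd x = j}"
proof -
  obtain j where j: "\<forall>x\<in>H. snd x = j" "H \<subseteq> Verts C"
    using assms by (auto simp: max_vertical_def vertical_interval_def)
  let ?R = "{x \<in> Verts C. snd x = j}"
  have "vertical_interval C ?R"
    unfolding vertical_interval_def
  proof (intro conjI ballI)
    fix x y assume "x \<in> ?R" "y \<in> ?R"
    then have *: "x = (fst x, j)" "y = (fst y, j)" "x \<in> Verts C" "y \<in> Verts C"
      by (auto simp: prod_eq_iff)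
    then show "joined (\<Union>\<delta>\<in>C. vedges \<delta>) x y"
      using joined_trans[OF joined_border(2) joined_sym[OF joined_border(2)]] by metis
  qed auto
  moreover have "H \<subseteq> ?R"
    using j by auto
  ultimately show ?thesis
    using assms by (auto simp: max_vertical_def)
qed

text \<open>Intervals are full rows and columns, so the cycle can be read off as row numbers
  \<open>a\<close> and column numbers \<open>b\<close>, which are then extended
  periodically.\<close>

lemma is_cycle_cycle:
  assumes c: "is_cycle C hs vs"
  obtains i j where "cycle (length hs) i j" "cyc_verts hs vs \<subseteq> support i j"
proof -
  define r where "r = length hs"
  have r: "2 \<le> r" "length vs = r" "distinct hs" "distinct vs"
    using c by (auto simp: is_cycle_def r_def)
  have edge: "hs ! k \<in> max_horizontal C" "vs ! k \<in> max_vertical C" "hs ! k \<inter> vs ! k \<noteq> {}"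
    "hs ! (Suc k mod r) \<inter> vs ! k \<noteq> {}" if "k < r" for k
    using c that by (fastforce simp: is_cycle_def graph_edges_def doubleton_eq_iff r_def)+
  obtain a where a: "\<And>k. k < r \<Longrightarrow> hs ! k = {x \<in> Verts C. fst x = a k}"
    using max_horizontal_row[OF edge(1)] by metis
  obtain b where b: "\<And>k. k < r \<Longrightarrow> vs ! k = {x \<in> Verts C. snd x = b k}"
    using max_vertical_col[OF edge(2)] by metis
  \<comment> \<open>A row and a column share at most one position, the one that
    \<open>the_elem\<close> returns.\<close>
  have inter: "hs ! k \<inter> vs ! l = {(a k, b l)} \<and> (a k, b l) \<in> Verts C"
    if "k < r" "l < r" "hs ! k \<inter> vs ! l \<noteq> {}" for k l
    using that a b by auto
  define i j where "i k = a (k mod r)" and "j k = b (k mod r)" for k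
  have m: "k mod r < r" for k
    using r by simp
  have V: "hs ! (k mod r) \<inter> vs ! (k mod r) = {(i k, j k)} \<and> (i k, j k) \<in> Verts C"
    "hs ! (Suc k mod r) \<inter> vs ! (k mod r) = {(i (Suc k), j k)} \<and> (i (Suc k), j k) \<in> Verts C" for k
    using inter[OF m m edge(3)[OF m]] inter[OF m m, of "Suc (k mod r)" k] edge(4)[OF m, of k]
    by (simp_all add: i_def j_def mod_Suc_eq)
  have inj: "k = l" if "a k = a l \<or> b k = b l" "k < r" "l < r" for k l
  proof -
    have "hs ! k = hs ! l \<or> vs ! k = vs ! l"
      using that a b by auto
    then show ?thesis
      using that r by (simp add: r_def nth_eq_iff_index_eq)
  qed
  have "i k = i l \<longleftrightarrow> k mod r = l mod r" "j k = j l \<longleftrightarrow> k mod r = l mod r" for k l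
    unfolding i_def j_def using inj[OF _ m m, of k l] by auto
  then have "cycle r i j"
    using r V by (simp add: cycle_def)
  moreover have "cyc_pos hs vs k = (i k, j k)" "cyc_pos' hs vs k = (i (Suc k), j k)" if "k < r" for k
    using V[of k] that by (simp_all add: cyc_pos_def cyc_pos'_def r_def)
  then have "cyc_verts hs vs \<subseteq> support i j"
    by (auto simp: cyc_verts_def support_def r_def)
  ultimately show thesis
    using that by (simp add: r_def)
qed

section \<open>Transfer of the hypotheses on tables to multisets of units\<close>

lemma heavyI:
  assumes "\<And>W. W \<in> min_prime_sets TYPE('k::field) C \<Longrightarrow> W \<noteq> {} \<Longrightarrow> 2 \<le> sum (count M) W"
  shows "heavy M"
  unfolding heavy_def
proof (intro allI impI)
  fix J x assume J: "indep J" "x \<in> J" "branching x"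
  obtain W where W: "W \<in> min_prime_sets TYPE('k) C" "W \<noteq> {}" "W \<subseteq> border - J"
    by (rule branching_min_prime_set[OF J])
  have fin: "finite (border - J)"
    using finite_Verts by (auto simp: border_def)
  have "2 \<le> sum (count M) W"
    using W assms by blast
  also have "\<dots> \<le> sum (count M) (border - J)"
    using fin W(3) by (intro sum_mono2) auto
  finally show "2 \<le> weight (border - J) M"
    using fin by (simp add: weight_sum)
qed

end

theorem corollary4p8:
  fixes K :: "'k::field itself"
    and m n :: nat
    and C :: "minor set"
    and U V :: "pos \<Rightarrow> nat"
  assumes "C \<subseteq> minors m n"
    and "\<forall>\<delta>\<in>C. corner \<delta>"
    and "U \<in> tables C" and "V \<in> tables C"
    and "\<forall>W \<in> min_prime_sets K C - {{}}. (\<Sum>x\<in>W. U x) \<ge> 2 \<and> (\<Sum>x\<in>W. V x) \<ge> 2"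
    and "\<forall>i\<in>{1..m}. row_sum C U i = row_sum C V i"
    and "\<forall>j\<in>{1..n}. col_sum C U j = col_sum C V j"
    and "\<exists>hs vs. is_cycle C hs vs \<and>
           (\<forall>x\<in>Verts C. U x \<noteq> 0 \<or> V x \<noteq> 0 \<longrightarrow> x \<in> cyc_verts hs vs)"
  shows "connected_via C U V"
proof -
  have minor: "\<exists>a b. \<delta> = Minor 1 a 1 b \<and> 2 \<le> a \<and> 2 \<le> b \<and> a \<le> m \<and> b \<le> n" if "\<delta> \<in> C" for \<delta>
    using assms(1,2) that by (cases \<delta>) (fastforce simp: minors_def)
  have "minors m n \<subseteq> (\<lambda>(a1, a2, b1, b2). Minor a1 a2 b1 b2) ` ({..m} \<times> {..m} \<times> {..n} \<times> {..n})"
    (is "_ \<subseteq> ?f ` ?A")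
  proof
    fix \<delta> assume "\<delta> \<in> minors m n"
    then obtain a1 a2 b1 b2 where "\<delta> = Minor a1 a2 b1 b2" "a1 < a2" "a2 \<le> m" "b1 < b2" "b2 \<le> n"
      by (auto simp: minors_def)
    then show "\<delta> \<in> ?f ` ?A"
      by (intro image_eqI[of _ _ "(a1, a2, b1, b2)"]) auto
  qed
  then have "finite (minors m n)"
    by (rule finite_subset) simp
  then interpret corner_minors C
    using assms(1) minor by unfold_locales (blast intro: finite_subset)+
  obtain hs vs where c: "is_cycle C hs vs"
    and sup: "\<And>x. x \<in> Verts C \<Longrightarrow> U x \<noteq> 0 \<or> V x \<noteq> 0 \<Longrightarrow> x \<in> cyc_verts hs vs"
    using assms(8) by blast
  obtain i j where ij: "cycle (length hs) i j" "cyc_verts hs vs \<subseteq> support i j"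
    by (rule is_cycle_cycle[OF c])
  have fin: "finite {x. 0 < u x}" if "u \<in> tables C" for u
  proof (rule finite_subset[OF _ finite_Verts])
    show "{x. 0 < u x} \<subseteq> Verts C"
      using that unfolding tables_def by fastforce
  qed
  \<comment> \<open>A table has finite support and is therefore the count function of a
    multiset.\<close>
  define MU MV where "MU = Abs_multiset U" and "MV = Abs_multiset V"
  have cnt: "count MU = U" "count MV = V"
    using fin assms(3,4) by (simp_all add: MU_def MV_def)
  have tab: "\<forall>x. x \<notin> Verts C \<longrightarrow> U x = 0" "\<forall>x. x \<notin> Verts C \<longrightarrow> V x = 0"
    using assms(3,4) by (simp_all only: tables_def mem_Collect_eq)
  have "x \<in> support i j" if "x \<in># MU \<or> x \<in># MV" for x
  proof -
    have "U x \<noteq> 0 \<or> V x \<noteq> 0"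
      using that unfolding count_greater_zero_iff[symmetric] cnt by auto
    moreover from this have "x \<in> Verts C"
      using tab by metis
    ultimately show ?thesis
      using sup ij(2) by blast
  qed
  then have "set_mset MU \<subseteq> support i j" "set_mset MV \<subseteq> support i j"
    by blast+
  moreover have "2 \<le> sum U W" "2 \<le> sum V W" if "W \<in> min_prime_sets TYPE('k) C" "W \<noteq> {}" for W
    using assms(5) that by (auto simp: min_prime_sets_def)
  then have "heavy MU" "heavy MV"
    using heavyI[where ?'k = 'k, of MU] heavyI[where ?'k = 'k, of MV] by (simp_all add: cnt)
  \<comment> \<open>All vertices lie within the \<open>m\<close> rows and \<open>n\<close> columns
    for which equal sums are assumed.\<close>
  moreover have "fst x \<in> {1..m} \<and> snd x \<in> {1..n}" if "x \<in> Verts C" for x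
    using that minor by (fastforce simp: Verts_def)
  then have "weight {y \<in> Verts C. fst y = fst x} MU = weight {y \<in> Verts C. fst y = fst x} MV"
    "weight {y \<in> Verts C. snd y = snd x} MU = weight {y \<in> Verts C. snd y = snd x} MV" if "x \<in> Verts C" for x
    using assms(6,7) that finite_Verts by (simp_all add: weight_sum cnt row_sum_def col_sum_def)
  ultimately have "conn MU MV"
    by (intro conn_cycle[OF ij(1)])
  then show ?thesis
    by (simp add: conn_def cnt)
qed

end
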